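(* Let $\Bbbk$ be a field of characteristic zero. Consider the following Poisson fields over $\Bbbk$: (1) $K_q = K\{qxy\}$ for $q\in\Bbbk^\times$; (2) $K_{\mathrm{Weyl}} = K\{1\}$ (which is isomorphic to $K_{1,1,0} = K\{x^2y\}$); (3) $K_{1,n,0} = K\{x^{n+1}y\}$ for integers $n\ge 2$. These Poisson fields are pairwise non-isomorphic (as Poisson $\Bbbk$-algebras), except for the isomorphisms $K_q\cong K_{-q}$. That is: $K_q\cong K_{q'}$ if and only if $q'=\pm q$; $K_{1,n,0}\cong K_{1,m,0}$ with $m,n\ge2$ only if $m=n$; and no Poisson field in one of the three classes is isomorphic to one in another class.
   Context: For $\mathbf f\in\Bbbk(x,y)$, $K\{\mathbf f\}$ denotes the rational function field $\Bbbk(x,y)$ equipped with the unique ($\Bbbk$-bilinear) Poisson bracket such that $\{x,y\}=\mathbf f$; explicitly $\{g,h\}=\left(\frac{\partial g}{\partial x}\frac{\partial h}{\partial y}-\frac{\partial g}{\partial y}\frac{\partial h}{\partial x}\right)\mathbf f$. Isomorphisms of Poisson fields are $\Bbbk$-algebra isomorphisms preserving the Poisson brackets. *)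

theory Defs
  imports "HOL-Computational_Algebra.Computational_Algebra"
begin

section \<open>The rational function field in two variables\<close>

text \<open>
  The polynomial ring \<open>k[x,y]\<close> is represented as \<open>k[x][y]\<close>: the variable of the coefficient
  polynomials is \<open>x\<close>, and the variable of the outer polynomial is \<open>y\<close>.
\<close>

type_synonym 'a ratfun2 = "'a poly poly fract"

definition ratconst :: "'a :: field_char_0 \<Rightarrow> 'a ratfun2" where
  "ratconst c = to_fract [:[:c:]:]"

definition ratX :: "'a :: field_char_0 ratfun2" where
  "ratX = to_fract [:[:0, 1:]:]"

definition ratY :: "'a :: field_char_0 ratfun2" where
  "ratY = to_fract [:0, 1:]"

definition polyDX :: "'a :: field_char_0 poly poly \<Rightarrow> 'a poly poly" where
  "polyDX = map_poly pderiv"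

definition polyDY :: "'a :: field_char_0 poly poly \<Rightarrow> 'a poly poly" where
  "polyDY = pderiv"

lemma coeff_polyDX: "coeff (polyDX p) n = pderiv (coeff p n)"
  by (simp add: polyDX_def coeff_map_poly)

lemma polyDX_add: "polyDX (p + q) = polyDX p + polyDX q"
  by (rule poly_eqI) (simp add: coeff_polyDX pderiv_add)

lemma polyDX_0 [simp]: "polyDX 0 = 0"
  by (simp add: polyDX_def)

lemma polyDX_pCons: "polyDX (pCons a p) = pCons (pderiv a) (polyDX p)"
  by (rule poly_eqI) (simp add: coeff_polyDX coeff_pCons split: nat.split)

lemma polyDX_smult: "polyDX (smult a p) = smult a (polyDX p) + smult (pderiv a) p"
  by (rule poly_eqI) (simp add: coeff_polyDX pderiv_mult algebra_simps)

lemma polyDX_mult: "polyDX (p * q) = p * polyDX q + q * polyDX p"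
  by (induction p) (simp_all add: polyDX_add polyDX_smult polyDX_pCons algebra_simps)

lemma polyDY_mult: "polyDY (p * q) = p * polyDY q + q * polyDY p"
  by (simp add: polyDY_def pderiv_mult)

lemma polyDY_add: "polyDY (p + q) = polyDY p + polyDY q"
  by (simp add: polyDY_def pderiv_add)

lemma polyDX_polyDY: "polyDX (polyDY p) = polyDY (polyDX p)"
  by (induction p) (simp_all add: polyDY_def polyDX_add polyDX_pCons pderiv_pCons)

lemma quotient_rule_cong:
  fixes \<delta> :: "'b :: idom \<Rightarrow> 'b"
  assumes mult: "\<And>p q. \<delta> (p * q) = p * \<delta> q + q * \<delta> p"
    and eq: "a * d = c * b"
  shows "(\<delta> a * b - a * \<delta> b) * d\<^sup>2 = (\<delta> c * d - c * \<delta> d) * b\<^sup>2"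
proof -
  have e: "a * \<delta> d + d * \<delta> a = c * \<delta> b + b * \<delta> c"
    using arg_cong[OF eq, of \<delta>] by (simp add: mult)
  have "(\<delta> a * b - a * \<delta> b) * d\<^sup>2 - (\<delta> c * d - c * \<delta> d) * b\<^sup>2
      = b * d * ((a * \<delta> d + d * \<delta> a) - (c * \<delta> b + b * \<delta> c))
        - (a * d - c * b) * (d * \<delta> b + b * \<delta> d)"
    by (simp add: algebra_simps power2_eq_square)
  then show ?thesis
    using e eq by simp
qed

text \<open>
  Extension of a derivation to the fraction field by the quotient rule. For a map \<open>\<delta>\<close> satisfying the
  Leibniz rule the right-hand side does not depend on the chosen fraction, so the description is
  proper; see \<open>fract_deriv_Fract\<close> below.
\<close>

definition fract_deriv :: "('b :: idom \<Rightarrow> 'b) \<Rightarrow> 'b fract \<Rightarrow> 'b fract" where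
  "fract_deriv \<delta> r =
     (THE d. \<forall>a b. b \<noteq> 0 \<longrightarrow> r = Fract a b \<longrightarrow> d = Fract (\<delta> a * b - a * \<delta> b) (b\<^sup>2))"

lemma fract_deriv_Fract:
  fixes \<delta> :: "'b :: idom \<Rightarrow> 'b"
  assumes mult: "\<And>p q. \<delta> (p * q) = p * \<delta> q + q * \<delta> p" and b: "b \<noteq> 0"
  shows "fract_deriv \<delta> (Fract a b) = Fract (\<delta> a * b - a * \<delta> b) (b\<^sup>2)"
  unfolding fract_deriv_def
proof (rule the_equality)
  show "\<forall>c d. d \<noteq> 0 \<longrightarrow> Fract a b = Fract c d \<longrightarrow>
      Fract (\<delta> a * b - a * \<delta> b) (b\<^sup>2) = Fract (\<delta> c * d - c * \<delta> d) (d\<^sup>2)"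
    using b quotient_rule_cong[of \<delta>, OF mult] by (auto simp: eq_fract)
qed (use b in blast)

definition ratDX :: "'a :: field_char_0 ratfun2 \<Rightarrow> 'a ratfun2" where
  "ratDX = fract_deriv polyDX"

definition ratDY :: "'a :: field_char_0 ratfun2 \<Rightarrow> 'a ratfun2" where
  "ratDY = fract_deriv polyDY"

section \<open>Poisson brackets\<close>

definition rat_derivation :: "('a :: field_char_0 ratfun2 \<Rightarrow> 'a ratfun2) \<Rightarrow> bool" where
  "rat_derivation D \<longleftrightarrow>
     (\<forall>g h. D (g + h) = D g + D h) \<and>
     (\<forall>c. D (ratconst c) = 0) \<and>
     (\<forall>g h. D (g * h) = g * D h + h * D g)"

definition is_poisson_bracket ::
  "('a :: field_char_0 ratfun2 \<Rightarrow> 'a ratfun2 \<Rightarrow> 'a ratfun2) \<Rightarrow> bool" where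
  "is_poisson_bracket B \<longleftrightarrow>
     (\<forall>g h l. B (g + h) l = B g l + B h l) \<and>
     (\<forall>g h l. B g (h + l) = B g h + B g l) \<and>
     (\<forall>c g h. B (ratconst c * g) h = ratconst c * B g h) \<and>
     (\<forall>c g h. B g (ratconst c * h) = ratconst c * B g h) \<and>
     (\<forall>g. B g g = 0) \<and>
     (\<forall>g h l. B g (B h l) + B h (B l g) + B l (B g h) = 0) \<and>
     (\<forall>g h l. B g (h * l) = B g h * l + h * B g l)"

definition poisson_bracket ::
  "'a :: field_char_0 ratfun2 \<Rightarrow> 'a ratfun2 \<Rightarrow> 'a ratfun2 \<Rightarrow> 'a ratfun2" where
  "poisson_bracket f g h = (ratDX g * ratDY h - ratDY g * ratDX h) * f"

text \<open>
  All the Poisson fields considered have the same underlying field extension of \<open>k\<close>, so a Poisson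
  field is given by its bracket: \<^const>\<open>poisson_bracket\<close> applied to \<open>f\<close> stands for \<open>K{f}\<close>.
\<close>

definition poisson_isomorphism ::
  "('a :: field_char_0 ratfun2 \<Rightarrow> 'a ratfun2 \<Rightarrow> 'a ratfun2) \<Rightarrow>
   ('a ratfun2 \<Rightarrow> 'a ratfun2 \<Rightarrow> 'a ratfun2) \<Rightarrow> ('a ratfun2 \<Rightarrow> 'a ratfun2) \<Rightarrow> bool" where
  "poisson_isomorphism B B' \<phi> \<longleftrightarrow>
     bij \<phi> \<and>
     (\<forall>g h. \<phi> (g + h) = \<phi> g + \<phi> h) \<and>
     (\<forall>g h. \<phi> (g * h) = \<phi> g * \<phi> h) \<and>
     (\<forall>c. \<phi> (ratconst c) = ratconst c) \<and>
     (\<forall>g h. \<phi> (B g h) = B' (\<phi> g) (\<phi> h))"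

definition poisson_isomorphic ::
  "('a :: field_char_0 ratfun2 \<Rightarrow> 'a ratfun2 \<Rightarrow> 'a ratfun2) \<Rightarrow>
   ('a ratfun2 \<Rightarrow> 'a ratfun2 \<Rightarrow> 'a ratfun2) \<Rightarrow> bool" (infix "\<cong>\<^sub>P" 50) where
  "B \<cong>\<^sub>P B' \<longleftrightarrow> (\<exists>\<phi>. poisson_isomorphism B B' \<phi>)"

definition K_q :: "'a :: field_char_0 \<Rightarrow> 'a ratfun2 \<Rightarrow> 'a ratfun2 \<Rightarrow> 'a ratfun2" where
  "K_q q = poisson_bracket (ratconst q * ratX * ratY)"

definition K_Weyl :: "'a :: field_char_0 ratfun2 \<Rightarrow> 'a ratfun2 \<Rightarrow> 'a ratfun2" where
  "K_Weyl = poisson_bracket 1"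

text \<open>\<open>K_1_0 n\<close> is the Poisson field \<open>K\<^bsub>1,n,0\<^esub>\<close>.\<close>

definition K_1_0 :: "nat \<Rightarrow> 'a :: field_char_0 ratfun2 \<Rightarrow> 'a ratfun2 \<Rightarrow> 'a ratfun2" where
  "K_1_0 n = poisson_bracket (ratX ^ (n + 1) * ratY)"

section \<open>Basic properties\<close>

lemma ratDX_Fract: "b \<noteq> 0 \<Longrightarrow> ratDX (Fract a b) = Fract (polyDX a * b - a * polyDX b) (b\<^sup>2)"
  by (simp add: ratDX_def fract_deriv_Fract polyDX_mult)

lemma ratDY_Fract: "b \<noteq> 0 \<Longrightarrow> ratDY (Fract a b) = Fract (polyDY a * b - a * polyDY b) (b\<^sup>2)"
  by (simp add: ratDY_def fract_deriv_Fract polyDY_mult)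

lemma polyD_1 [simp]: "polyDX 1 = 0" "polyDY 1 = 0"
  by (simp_all add: one_pCons polyDX_pCons polyDY_def)

lemma ratDX_to_fract: "ratDX (to_fract p) = to_fract (polyDX p)"
  by (simp add: to_fract_def ratDX_Fract)

lemma ratDY_to_fract: "ratDY (to_fract p) = to_fract (polyDY p)"
  by (simp add: to_fract_def ratDY_Fract)

lemma rat_derivation_ratDX: "rat_derivation ratDX"
  unfolding rat_derivation_def
proof (intro conjI allI)
  fix g h :: "'a ratfun2" and c :: 'a
  obtain a b where g: "g = Fract a b" "b \<noteq> 0" by (cases g)
  obtain c d where h: "h = Fract c d" "d \<noteq> 0" by (cases h)
  show "ratDX (g + h) = ratDX g + ratDX h"
    using g h by (simp add: ratDX_Fract polyDX_add polyDX_mult eq_fract)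
      (simp add: algebra_simps power2_eq_square)
  show "ratDX (g * h) = g * ratDX h + h * ratDX g"
    using g h by (simp add: ratDX_Fract polyDX_mult eq_fract)
      (simp add: algebra_simps power2_eq_square)
next
  show "ratDX (ratconst c) = 0" for c :: 'a
    by (simp add: ratconst_def ratDX_to_fract polyDX_pCons)
qed

lemma rat_derivation_ratDY: "rat_derivation ratDY"
  unfolding rat_derivation_def
proof (intro conjI allI)
  fix g h :: "'a ratfun2" and c :: 'a
  obtain a b where g: "g = Fract a b" "b \<noteq> 0" by (cases g)
  obtain c d where h: "h = Fract c d" "d \<noteq> 0" by (cases h)
  show "ratDY (g + h) = ratDY g + ratDY h"
    using g h by (simp add: ratDY_Fract polyDY_add polyDY_mult eq_fract)
      (simp add: algebra_simps power2_eq_square)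
  show "ratDY (g * h) = g * ratDY h + h * ratDY g"
    using g h by (simp add: ratDY_Fract polyDY_mult eq_fract)
      (simp add: algebra_simps power2_eq_square)
next
  show "ratDY (ratconst c) = 0" for c :: 'a
    by (simp add: ratconst_def ratDY_to_fract polyDY_def)
qed

lemma rat_derivationD:
  assumes "rat_derivation D"
  shows "D (g + h) = D g + D h" "D (g * h) = g * D h + h * D g" "D (ratconst c) = 0"
  using assms unfolding rat_derivation_def by blast+

lemmas ratDX_simps = rat_derivationD[OF rat_derivation_ratDX]
lemmas ratDY_simps = rat_derivationD[OF rat_derivation_ratDY]

lemma ratD_ratX [simp]: "ratDX ratX = 1" "ratDY ratX = 0"
  by (simp_all add: ratX_def ratDX_to_fract ratDY_to_fract polyDX_pCons polyDY_def pderiv_pCons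
      flip: one_pCons)

lemma ratD_ratY [simp]: "ratDX ratY = 0" "ratDY ratY = 1"
  by (simp_all add: ratY_def ratDX_to_fract ratDY_to_fract polyDX_pCons polyDY_def pderiv_pCons
      flip: one_pCons)

lemma rat_derivation_to_fract:
  assumes "rat_derivation D"
  shows "D (to_fract p) = D ratX * ratDX (to_fract p) + D ratY * ratDY (to_fract p)"
proof -
  let ?E = "\<lambda>g. D g - (D ratX * ratDX g + D ratY * ratDY g)"
  have E_add: "?E (g + h) = ?E g + ?E h"
    and E_mult: "?E (g * h) = g * ?E h + h * ?E g"
    and E_const: "?E (ratconst c) = 0" for g h c
    by (simp_all add: rat_derivationD[OF assms] ratDX_simps ratDY_simps algebra_simps)
  have E_XY: "?E ratX = 0" "?E ratY = 0"
    by simp_all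
  have zero: "?E 0 = 0"
    using E_const[of 0] by (simp add: ratconst_def)
  have inner: "?E (to_fract [:a:]) = 0" for a
  proof (induction a)
    case 0
    then show ?case using zero by simp
  next
    case (pCons c a)
    have *: "to_fract [:pCons c a:] = ratconst c + ratX * to_fract [:a:]"
      by (simp add: ratconst_def ratX_def flip: to_fract_add to_fract_mult)
    show ?case
      unfolding * E_add E_mult using pCons.IH E_const[of c] E_XY by simp
  qed
  have "?E (to_fract p) = 0"
  proof (induction p)
    case 0
    then show ?case using zero by simp
  next
    case (pCons a p)
    have *: "to_fract (pCons a p) = to_fract [:a:] + ratY * to_fract p"
      by (simp add: ratY_def flip: to_fract_add to_fract_mult)
    show ?case
      unfolding * E_add E_mult using pCons.IH inner[of a] E_XY by simp
  qed
  then show ?thesis by simp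
qed

lemma rat_derivation_eq:
  assumes "rat_derivation D"
  shows "D g = D ratX * ratDX g + D ratY * ratDY g"
proof -
  let ?E = "\<lambda>g. D g - (D ratX * ratDX g + D ratY * ratDY g)"
  have E_mult: "?E (g * h) = g * ?E h + h * ?E g" for g h
    by (simp add: rat_derivationD[OF assms] ratDX_simps ratDY_simps algebra_simps)
  have E_poly: "?E (to_fract p) = 0" for p
    using rat_derivation_to_fract[OF assms, of p] by simp
  obtain a b where g: "g = Fract a b" "b \<noteq> 0" by (cases g)
  have "g * to_fract b = to_fract a"
    using g by (simp add: Fract_conv_to_fract)
  then have "to_fract b * ?E g = 0"
    using E_mult[of g "to_fract b"] E_poly[of a] E_poly[of b] by simp
  with g show ?thesis by simp
qed

lemma ratDX_ratDY:
  fixes g :: "'a :: field_char_0 ratfun2"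
  shows "ratDX (ratDY g) = ratDY (ratDX g)"
proof -
  let ?C = "\<lambda>g :: 'a ratfun2. ratDX (ratDY g) - ratDY (ratDX g)"
  have 0: "ratDX 0 = (0 :: 'a ratfun2)" "ratDY 0 = (0 :: 'a ratfun2)"
    using ratDX_simps(3)[of 0] ratDY_simps(3)[of 0] by (simp_all add: ratconst_def)
  have 1: "ratDX 1 = (0 :: 'a ratfun2)" "ratDY 1 = (0 :: 'a ratfun2)"
    using ratDX_simps(3)[of 1] ratDY_simps(3)[of 1] by (simp_all add: ratconst_def flip: one_pCons)
  have "rat_derivation ?C"
    unfolding rat_derivation_def by (simp add: ratDX_simps ratDY_simps 0 algebra_simps)
  from rat_derivation_eq[OF this, of g] show ?thesis
    by (simp add: 0 1)
qed

lemma poisson_bracket_ratX_ratY: "poisson_bracket f ratX ratY = f"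
  by (simp add: poisson_bracket_def)

lemma is_poisson_bracket_poisson_bracket: "is_poisson_bracket (poisson_bracket f)"
proof -
  have diff: "ratDX (g - h) = ratDX g - ratDX h" "ratDY (g - h) = ratDY g - ratDY h"
    for g h :: "'a ratfun2"
    using ratDX_simps(1)[of "g - h" h] ratDY_simps(1)[of "g - h" h] by simp_all
  show ?thesis
    unfolding is_poisson_bracket_def poisson_bracket_def
    by (simp add: ratDX_simps ratDY_simps diff ratDX_ratDY algebra_simps)
qed

theorem poisson_bracket_unique: "\<exists>!B. is_poisson_bracket B \<and> B ratX ratY = f"
proof (rule ex1I)
  show "is_poisson_bracket (poisson_bracket f) \<and> poisson_bracket f ratX ratY = f"
    by (simp add: is_poisson_bracket_poisson_bracket poisson_bracket_ratX_ratY)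
next
  fix B :: "'a ratfun2 \<Rightarrow> 'a ratfun2 \<Rightarrow> 'a ratfun2"
  assume B: "is_poisson_bracket B \<and> B ratX ratY = f"
  then have addl: "B (g + h) l = B g l + B h l" and addr: "B g (h + l) = B g h + B g l"
    and lin: "B g (ratconst c * h) = ratconst c * B g h"
    and alt: "B g g = 0" and leib: "B g (h * l) = B g h * l + h * B g l" for g h l c
    unfolding is_poisson_bracket_def by blast+
  have anti: "B g h = - B h g" for g h
  proof -
    have "B g h + B h g = 0"
      using alt[of "g + h"] alt[of g] alt[of h] unfolding addl addr by (simp add: add.commute)
    then show ?thesis by (simp add: eq_neg_iff_add_eq_0)
  qed
  have B1: "B g 1 = 0" for g
    using leib[of g 1 1] unfolding mult_1 mult_1_right by (metis add_cancel_right_right)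
  have der: "rat_derivation (B g)" for g
    unfolding rat_derivation_def
  proof (intro conjI allI)
    show "B g (ratconst c) = 0" for c
      using lin[of g c 1] B1[of g] by simp
  qed (simp_all add: addr leib algebra_simps)
  have 1: "B g h = B g ratX * ratDX h + B g ratY * ratDY h" for g h
    by (rule rat_derivation_eq[OF der])
  have BX: "B g ratX = - (f * ratDY g)" and BY: "B g ratY = f * ratDX g" for g
  proof -
    have "B ratY ratX = - f"
      using anti[of ratY ratX] B by simp
    then show "B g ratX = - (f * ratDY g)" "B g ratY = f * ratDX g"
      unfolding anti[of g ratX] anti[of g ratY] 1[of ratX g] 1[of ratY g] using B by (simp_all add: alt)
  qed
  show "B = poisson_bracket f"
  proof (intro ext)
    show "B g h = poisson_bracket f g h" for g h
      using 1[of g h] by (simp add: BX BY poisson_bracket_def algebra_simps)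
  qed
qed

lemma poisson_isomorphic_refl: "B \<cong>\<^sub>P B"
  unfolding poisson_isomorphic_def poisson_isomorphism_def
  by (rule exI[of _ id]) simp

lemma poisson_isomorphic_sym:
  assumes "B \<cong>\<^sub>P B'"
  shows "B' \<cong>\<^sub>P B"
proof -
  obtain \<phi> where "bij \<phi>"
    and hom: "\<And>g h. \<phi> (g + h) = \<phi> g + \<phi> h" "\<And>g h. \<phi> (g * h) = \<phi> g * \<phi> h"
      "\<And>c. \<phi> (ratconst c) = ratconst c" "\<And>g h. \<phi> (B g h) = B' (\<phi> g) (\<phi> h)"
    using assms unfolding poisson_isomorphic_def poisson_isomorphism_def by blast
  then have inv: "\<phi> (inv \<phi> g) = g" and eqI: "\<phi> g = \<phi> h \<Longrightarrow> g = h" for g h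
    by (simp_all add: bij_is_surj surj_f_inv_f bij_is_inj inj_eq)
  have "poisson_isomorphism B' B (inv \<phi>)"
    unfolding poisson_isomorphism_def
    by (intro conjI allI bij_imp_bij_inv \<open>bij \<phi>\<close>; rule eqI; simp add: hom inv)
  then show ?thesis
    unfolding poisson_isomorphic_def by blast
qed

end

theory Submission
  imports Defs
begin

text \<open>
  The Poisson field \<open>K{f}\<close> carries the 2-form \<open>dx \<and> dy / f\<close>, and a Poisson isomorphism is a field
  isomorphism matching these forms. Expanding rational functions in the iterated Laurent series field
  \<open>k((x))((y))\<close>, the residue (the coefficient of \<open>x\<^sup>-\<^sup>1y\<^sup>-\<^sup>1\<close>) of a form \<open>dlog g \<and> dlog h\<close> is an integer and the
  residue of an exact form is \<open>0\<close>. The first fact gives \<open>q = \<plusminus>q'\<close> when \<open>K\<^sub>q \<cong> K\<^bsub>q'\<^esub>\<close>. The second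
  separates \<open>K\<^sub>q\<close> from \<open>K\<^bsub>1,n,0\<^esub>\<close> for \<open>n \<ge> 1\<close>, whose form \<open>x\<^bsup>-n\<^esup> dlog x \<and> dlog y\<close> is exact.

  To recover \<open>n\<close> from \<open>K\<^bsub>1,n,0\<^esub>\<close>, transport the \<open>y\<close>-adic valuation of \<open>K\<^bsub>1,m,0\<^esub>\<close>: along it the form has a
  simple pole with residue form \<open>x\<^bsup>-m-1\<^esup> dx\<close>. In \<open>K\<^bsub>1,n,0\<^esub>\<close> every divisorial valuation along which the form
  has a simple pole is reached from the coordinates by toric changes of coordinates and translations
  of a coordinate by a constant. If no translation is needed the residue form is, up to a constant,
  \<open>u\<^bsup>j-1\<^esup> du\<close> with \<open>\<bar>j\<bar> = n\<close>; after a translation it is so with \<open>\<bar>j\<bar> = 1\<close>. Here \<open>u\<close> generates the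
  residue field \<open>k(x)\<close>, so comparison with \<open>x\<^bsup>-m-1\<^esup> dx\<close> forces \<open>m = \<bar>j\<bar>\<close> or \<open>m = 1\<close>.
\<close>

section \<open>Homomorphisms from the rational function field\<close>

locale comm_ring_hom =
  fixes h :: "'r :: comm_ring_1 \<Rightarrow> 's :: comm_ring_1"
  assumes add: "h (a + b) = h a + h b"
    and mult: "h (a * b) = h a * h b"
    and one: "h 1 = 1"
begin

lemma zero: "h 0 = 0"
  using add[of 0 0] by simp

lemma uminus: "h (- a) = - h a"
  using add[of a "- a"] by (simp add: zero eq_neg_iff_add_eq_0 add.commute)

lemma diff: "h (a - b) = h a - h b"
  using add[of a "- b"] by (simp add: uminus)

lemma power: "h (a ^ n) = h a ^ n"
  by (induction n) (simp_all add: one mult)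

lemma of_nat: "h (of_nat n) = of_nat n"
  by (induction n) (simp_all add: zero add one)

end

locale field_hom = comm_ring_hom h for h :: "'r :: field \<Rightarrow> 's :: field"
begin

lemma eq_0_iff: "h a = 0 \<longleftrightarrow> a = 0"
proof
  assume *: "h a = 0"
  show "a = 0"
  proof (rule ccontr)
    assume "a \<noteq> 0"
    then have "h a * h (inverse a) = 1"
      by (simp add: one flip: mult)
    with * show False by simp
  qed
qed (simp add: zero)

lemma inverse: "h (inverse a) = inverse (h a)"
proof (cases "a = 0")
  case False
  then have "h a * h (inverse a) = 1"
    by (simp add: one flip: mult)
  then show ?thesis by (metis inverse_unique)
qed (simp add: zero)

lemma divide: "h (a / b) = h a / h b"
  by (simp add: field_class.field_divide_inverse mult inverse)

end

lemma comm_ring_hom_ratconst: "comm_ring_hom ratconst"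
  by standard (simp_all add: ratconst_def flip: to_fract_add to_fract_mult one_pCons)

text \<open>Nested as \<open>poly_hom (poly_hom c a) b\<close>, this substitutes x = a and y = b in
  k[x][y].\<close>

definition poly_hom :: "('r :: comm_ring_1 \<Rightarrow> 's :: comm_ring_1) \<Rightarrow> 's \<Rightarrow> 'r poly \<Rightarrow> 's" where
  "poly_hom h a p = poly (map_poly h p) a"

context comm_ring_hom
begin

lemma poly_hom_pCons: "poly_hom h a (pCons c p) = h c + a * poly_hom h a p"
  by (simp add: poly_hom_def map_poly_pCons zero)

lemma poly_hom_0: "poly_hom h a 0 = 0"
  by (simp add: poly_hom_def)

lemma poly_hom_add: "poly_hom h a (p + q) = poly_hom h a p + poly_hom h a q"
  by (induction p q rule: poly_induct2) (simp_all add: poly_hom_pCons poly_hom_0 add algebra_simps)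

lemma poly_hom_smult: "poly_hom h a (smult c p) = h c * poly_hom h a p"
  by (induction p) (simp_all add: poly_hom_pCons poly_hom_0 mult algebra_simps)

lemma poly_hom_mult: "poly_hom h a (p * q) = poly_hom h a p * poly_hom h a q"
  by (induction p)
    (simp_all add: poly_hom_pCons poly_hom_0 poly_hom_add poly_hom_smult zero algebra_simps)

lemma comm_ring_hom_poly_hom: "comm_ring_hom (poly_hom h a)"
  by standard (simp_all add: poly_hom_add poly_hom_mult poly_hom_pCons poly_hom_0 one one_pCons)

end

section \<open>Derivations trivial on the constants\<close>

definition alg_derivation :: "('a \<Rightarrow> 'f :: field) \<Rightarrow> ('f \<Rightarrow> 'f) \<Rightarrow> bool" where
  "alg_derivation c D \<longleftrightarrow>
     (\<forall>f g. D (f + g) = D f + D g) \<and>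
     (\<forall>f g. D (f * g) = f * D g + g * D f) \<and>
     (\<forall>k. D (c k) = 0)"

lemma alg_derivationD:
  assumes "alg_derivation c D"
  shows "D (f + g) = D f + D g" "D (f * g) = f * D g + g * D f" "D (c k) = 0"
  using assms unfolding alg_derivation_def by blast+

lemma alg_derivation_ratD:
  "alg_derivation ratconst ratDX" "alg_derivation ratconst ratDY"
  unfolding alg_derivation_def using ratDX_simps ratDY_simps by blast+

context
  fixes c :: "'a \<Rightarrow> 'f :: field" and D :: "'f \<Rightarrow> 'f"
  assumes D: "alg_derivation c D"
begin

lemma derivation_0: "D 0 = 0"
  using alg_derivationD(1)[OF D, of 0 0] by (metis add.right_neutral add_cancel_right_right)

lemma derivation_1: "D 1 = 0"
  using alg_derivationD(2)[OF D, of 1 1] by (metis add_cancel_right_right mult_1)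

lemma derivation_uminus: "D (- f) = - D f"
  using alg_derivationD(1)[OF D, of f "- f"]
  by (simp add: derivation_0 eq_neg_iff_add_eq_0 add.commute)

lemma derivation_diff: "D (f - g) = D f - D g"
  using alg_derivationD(1)[OF D, of f "- g"] by (simp add: derivation_uminus)

lemma derivation_inverse:
  assumes "f \<noteq> 0"
  shows "D (inverse f) = - D f / f\<^sup>2"
proof -
  have "0 = f * D (inverse f) + inverse f * D f"
    using alg_derivationD(2)[OF D, of f "inverse f"] assms by (simp add: derivation_1)
  then show ?thesis
    using assms by (simp add: field_simps power2_eq_square eq_neg_iff_add_eq_0)
qed

lemma derivation_power: "D (f ^ n) * f = of_nat n * f ^ n * D f"
  by (induction n) (simp_all add: derivation_1 alg_derivationD(2)[OF D] algebra_simps)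

lemma derivation_power_int:
  assumes "f \<noteq> 0"
  shows "D (f powi n) = of_int n * f powi n * (D f / f)"
proof (cases "n \<ge> 0")
  case True
  then obtain k where "n = int k" by (metis nonneg_int_cases)
  with derivation_power[of f k] assms show ?thesis
    by (simp add: field_simps)
next
  case False
  then obtain k where k: "n = - int k" by (metis int_cases2 of_nat_0_le_iff)
  have 1: "D (f ^ k) = of_nat k * f ^ k * D f / f"
    using derivation_power[of f k] assms by (simp add: field_simps)
  have "D (f powi n) = D (inverse (f ^ k))"
    by (simp add: k power_int_minus)
  also have "\<dots> = - D (f ^ k) / (f ^ k)\<^sup>2"
    using assms by (intro derivation_inverse) simp
  also have "\<dots> = of_int n * f powi n * (D f / f)"
    using assms by (simp add: k 1 power_int_minus power2_eq_square field_simps)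
  finally show ?thesis .
qed

end

text \<open>Chain rule for the substitution x = a, y = b, first for the coefficients in k[x] and
  then for the polynomial in y.\<close>

lemma derivation_poly_poly_hom:
  fixes c :: "'a :: field_char_0 \<Rightarrow> 'f :: field"
  assumes c: "comm_ring_hom c" and D: "alg_derivation c D"
  shows "D (poly_hom (poly_hom c a) b p) =
    poly_hom (poly_hom c a) b (polyDX p) * D a + poly_hom (poly_hom c a) b (polyDY p) * D b"
proof -
  interpret c: comm_ring_hom c by fact
  interpret ca: comm_ring_hom "poly_hom c a" by (rule c.comm_ring_hom_poly_hom)
  have 1: "D (poly_hom c a q) = poly_hom c a (pderiv q) * D a" for q
    by (induction q) (simp_all add: c.poly_hom_0 c.poly_hom_pCons c.poly_hom_add pderiv_pCons
        alg_derivationD[OF D] derivation_0[OF D] c.zero algebra_simps)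
  show ?thesis
    by (induction p) (simp_all add: ca.poly_hom_0 ca.poly_hom_pCons ca.poly_hom_add polyDY_def
        polyDX_pCons pderiv_pCons alg_derivationD[OF D] derivation_0[OF D] ca.zero 1 algebra_simps)
qed

text \<open>
  Jacobian criterion: if \<open>p(a, b) = 0\<close>, then differentiating with two derivations and inverting the
  Jacobian matrix shows that both partial derivatives of \<open>p\<close> vanish at \<open>(a, b)\<close>.
\<close>

lemma poly_poly_hom_eq_0:
  fixes c :: "'a :: field_char_0 \<Rightarrow> 'f :: field"
  assumes c: "comm_ring_hom c" and D: "alg_derivation c D" and D': "alg_derivation c D'"
    and J: "D a * D' b - D b * D' a \<noteq> 0"
    and p: "poly_hom (poly_hom c a) b p = 0"
  shows "p = 0"
proof -
  interpret c: comm_ring_hom c by fact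
  interpret ca: comm_ring_hom "poly_hom c a" by (rule c.comm_ring_hom_poly_hom)
  have inv: "s = 0 \<and> t = 0" if "s * D a + t * D b = 0" "s * D' a + t * D' b = 0" for s t
  proof -
    have "s * (D a * D' b - D b * D' a) = (s * D a + t * D b) * D' b - (s * D' a + t * D' b) * D b"
      "t * (D a * D' b - D b * D' a) = (s * D' a + t * D' b) * D a - (s * D a + t * D b) * D' a"
      by (simp_all add: algebra_simps)
    with that have "s * (D a * D' b - D b * D' a) = 0" "t * (D a * D' b - D b * D' a) = 0"
      by (simp_all only: mult_zero_left diff_self)
    with J show ?thesis by (metis mult_eq_0_iff)
  qed
  have partials: "poly_hom (poly_hom c a) b (polyDX p) = 0 \<and> poly_hom (poly_hom c a) b (polyDY p) = 0"
    if "poly_hom (poly_hom c a) b p = 0" for p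
    using that derivation_poly_poly_hom[OF c D, of a b p] derivation_poly_poly_hom[OF c D', of a b p]
    by (intro inv) (simp_all add: derivation_0[OF D] derivation_0[OF D'])
  \<comment> \<open>Induction on the degree: the derivative vanishes at the point as well, so it is
    zero, and in characteristic zero \<open>q\<close> is constant. The same argument in y below
    reduces \<open>p\<close> to such a \<open>q\<close>.\<close>
  have const: "q = 0" if "poly_hom (poly_hom c a) b [:q:] = 0" for q
    using that
  proof (induction "degree q" arbitrary: q rule: less_induct)
    case less
    have "poly_hom (poly_hom c a) b [:pderiv q:] = 0"
      using partials[OF less.prems] by (simp add: polyDX_pCons)
    then have 0: "pderiv q = 0"
      using less.hyps[of "pderiv q"] by (cases "degree q = 0") (auto simp: degree_pderiv pderiv_eq_0_iff)
    then obtain k where k: "q = [:k:]"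
      by (metis degree_eq_zeroE pderiv_eq_0_iff)
    interpret fc: field_hom c ..
    from less.prems k have "c k = 0"
      by (simp add: ca.poly_hom_pCons ca.poly_hom_0 c.poly_hom_pCons c.poly_hom_0)
    with k show ?case by (simp add: fc.eq_0_iff)
  qed
  show ?thesis
    using p
  proof (induction "degree p" arbitrary: p rule: less_induct)
    case less
    have "polyDY p = 0"
    proof (cases "degree p = 0")
      case True
      then show ?thesis by (simp add: polyDY_def pderiv_eq_0_iff)
    next
      case False
      then show ?thesis
        using less.hyps[of "polyDY p"] partials[OF less.prems] by (simp add: polyDY_def degree_pderiv)
    qed
    then obtain q where "p = [:q:]"
      by (metis degree_eq_zeroE pderiv_eq_0_iff polyDY_def)
    with less.prems const show ?case by simp
  qed
qed

section \<open>Substitution homomorphisms on k(x,y)\<close>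

definition fract_lift :: "('r :: idom \<Rightarrow> 'f :: field) \<Rightarrow> 'r fract \<Rightarrow> 'f" where
  "fract_lift E r = (THE d. \<forall>a b. b \<noteq> 0 \<longrightarrow> r = Fract a b \<longrightarrow> d = E a / E b)"

context
  fixes E :: "'r :: idom \<Rightarrow> 'f :: field"
  assumes E: "comm_ring_hom E" and inj: "\<And>p. E p = 0 \<Longrightarrow> p = 0"
begin

interpretation E: comm_ring_hom E by (fact E)

lemma fract_lift_Fract:
  assumes b: "b \<noteq> 0"
  shows "fract_lift E (Fract a b) = E a / E b"
  unfolding fract_lift_def
proof (rule the_equality)
  show "\<forall>c d. d \<noteq> 0 \<longrightarrow> Fract a b = Fract c d \<longrightarrow> E a / E b = E c / E d"
  proof (intro allI impI)
    fix c d
    assume d: "d \<noteq> 0" and "Fract a b = Fract c d"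
    then have "E a * E d = E c * E b"
      using b by (simp add: eq_fract flip: E.mult)
    then show "E a / E b = E c / E d"
      using inj[of b] inj[of d] b d by (subst frac_eq_eq) auto
  qed
qed (use b in blast)

lemma fract_lift_to_fract: "fract_lift E (to_fract p) = E p"
  by (simp add: to_fract_def fract_lift_Fract E.one)

lemma field_hom_fract_lift: "field_hom (fract_lift E)"
proof -
  have "fract_lift E (g + h) = fract_lift E g + fract_lift E h \<and>
      fract_lift E (g * h) = fract_lift E g * fract_lift E h" for g h
  proof -
    obtain a b where g: "g = Fract a b" "b \<noteq> 0" by (cases g)
    obtain c d where h: "h = Fract c d" "d \<noteq> 0" by (cases h)
    have "E b \<noteq> 0" "E d \<noteq> 0" using inj g h by blast+
    then show ?thesis
      using g h by (simp add: fract_lift_Fract E.add E.mult field_simps)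
  qed
  moreover have "fract_lift E 1 = 1"
    using fract_lift_to_fract[of 1] by (simp add: E.one)
  ultimately show ?thesis by unfold_locales blast+
qed

end

text \<open>A nonzero Jacobian makes evaluation at (a, b) injective on polynomials, so it extends to
  the fraction field.\<close>

lemma ratfun_hom_exists:
  fixes c :: "'a :: field_char_0 \<Rightarrow> 'f :: field"
  assumes c: "comm_ring_hom c" and D: "alg_derivation c D" and D': "alg_derivation c D'"
    and J: "D a * D' b - D b * D' a \<noteq> 0"
  obtains \<phi> :: "'a ratfun2 \<Rightarrow> 'f"
  where "field_hom \<phi>" "\<And>k. \<phi> (ratconst k) = c k" "\<phi> ratX = a" "\<phi> ratY = b"
proof
  interpret c: comm_ring_hom c by fact
  interpret ca: comm_ring_hom "poly_hom c a" by (rule c.comm_ring_hom_poly_hom)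
  let ?E = "poly_hom (poly_hom c a) b"
  have E: "comm_ring_hom ?E" by (rule ca.comm_ring_hom_poly_hom)
  have inj: "\<And>p. ?E p = 0 \<Longrightarrow> p = 0"
    using poly_poly_hom_eq_0[OF c D D' J] by blast
  show "field_hom (fract_lift ?E)" by (rule field_hom_fract_lift[OF E inj])
  note lift = fract_lift_to_fract[OF E inj]
  show "fract_lift ?E (ratconst k) = c k" for k
    by (simp add: ratconst_def lift ca.poly_hom_pCons ca.poly_hom_0 c.poly_hom_pCons c.poly_hom_0)
  show "fract_lift ?E ratX = a"
    by (simp add: ratX_def lift ca.poly_hom_pCons ca.poly_hom_0 c.poly_hom_pCons c.poly_hom_0
        c.zero c.one)
  show "fract_lift ?E ratY = b"
    by (simp add: ratY_def lift ca.poly_hom_pCons ca.poly_hom_0 c.poly_hom_pCons c.poly_hom_0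
        ca.zero ca.one c.zero c.one one_pCons)
qed

section \<open>Subfields containing the constants, and the chain rule\<close>

definition subfield_over :: "('a \<Rightarrow> 'f :: field) \<Rightarrow> 'f set \<Rightarrow> bool" where
  "subfield_over c S \<longleftrightarrow> range c \<subseteq> S \<and> (\<forall>f\<in>S. \<forall>g\<in>S. f + g \<in> S \<and> f * g \<in> S) \<and>
     (\<forall>f\<in>S. inverse f \<in> S)"

lemma subfield_overD:
  assumes "subfield_over c S"
  shows "c k \<in> S" "f \<in> S \<Longrightarrow> g \<in> S \<Longrightarrow> f + g \<in> S" "f \<in> S \<Longrightarrow> g \<in> S \<Longrightarrow> f * g \<in> S"
    "f \<in> S \<Longrightarrow> inverse f \<in> S"
  using assms unfolding subfield_over_def by blast+

lemma subfield_over_power_int: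
  fixes c :: "'a :: comm_ring_1 \<Rightarrow> 'f :: field"
  assumes "comm_ring_hom c" "subfield_over c S" "f \<in> S"
  shows "f powi n \<in> S"
proof -
  have "f ^ k \<in> S" for k
    using assms(3) subfield_overD(3)[OF assms(2)] subfield_overD(1)[OF assms(2), of 1]
    by (induction k) (auto simp: comm_ring_hom.one[OF assms(1)])
  then show ?thesis
    by (auto simp: power_int_def power_inverse subfield_overD(4)[OF assms(2)])
qed

text \<open>Serves as an induction principle: a property preserved by sums, products and inverses
  need only be checked on the constants, x and y.\<close>

lemma ratfun_mem_subfield:
  assumes S: "subfield_over ratconst S" and X: "ratX \<in> S" and Y: "ratY \<in> S"
  shows "g \<in> S"
proof -
  have inner: "to_fract [:q:] \<in> S" for q
  proof (induction q)
    case 0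
    then show ?case using subfield_overD(1)[OF S, of 0] by (simp add: ratconst_def)
  next
    case (pCons c q)
    have "to_fract [:pCons c q:] = ratconst c + ratX * to_fract [:q:]"
      by (simp add: ratconst_def ratX_def flip: to_fract_add to_fract_mult)
    then show ?case using pCons.IH X subfield_overD[OF S] by metis
  qed
  have poly: "to_fract p \<in> S" for p
  proof (induction p)
    case 0
    then show ?case using inner[of 0] by simp
  next
    case (pCons q p)
    have "to_fract (pCons q p) = to_fract [:q:] + ratY * to_fract p"
      by (simp add: ratY_def flip: to_fract_add to_fract_mult)
    then show ?case using pCons.IH inner[of q] Y subfield_overD[OF S] by metis
  qed
  obtain a b where "g = Fract a b" by (cases g)
  then have "g = to_fract a * inverse (to_fract b)"
    by (simp add: Fract_conv_to_fract field_class.field_divide_inverse)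
  then show ?thesis using poly subfield_overD[OF S] by metis
qed

text \<open>The elements satisfying the identity form a subfield, by the sum, product and quotient
  rules, and it contains x and y.\<close>

lemma derivation_chain_rule:
  fixes c :: "'a :: field_char_0 \<Rightarrow> 'f :: field"
  assumes \<phi>: "field_hom \<phi>" and const: "\<And>k. \<phi> (ratconst k) = c k" and D: "alg_derivation c D"
  shows "D (\<phi> g) = \<phi> (ratDX g) * D (\<phi> ratX) + \<phi> (ratDY g) * D (\<phi> ratY)"
proof -
  interpret \<phi>: field_hom \<phi> by fact
  let ?S = "{g. D (\<phi> g) = \<phi> (ratDX g) * D (\<phi> ratX) + \<phi> (ratDY g) * D (\<phi> ratY)}"
  have "subfield_over ratconst ?S"
    unfolding subfield_over_def
  proof (intro conjI ballI subsetI)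
    show "k \<in> ?S" if "k \<in> range ratconst" for k
      using that by (auto simp: const alg_derivationD[OF D] ratDX_simps ratDY_simps \<phi>.zero)
    show "g + h \<in> ?S" "g * h \<in> ?S" if "g \<in> ?S" "h \<in> ?S" for g h
      using that by (simp_all add: \<phi>.add \<phi>.mult alg_derivationD[OF D] ratDX_simps ratDY_simps
          algebra_simps)
    show "inverse g \<in> ?S" if "g \<in> ?S" for g
    proof (cases "g = 0")
      case True
      then show ?thesis using that by simp
    next
      case False
      then have "\<phi> g \<noteq> 0" by (simp add: \<phi>.eq_0_iff)
      with False that show ?thesis
        by (simp add: \<phi>.inverse derivation_inverse[OF D] \<phi>.divide \<phi>.uminus \<phi>.power
            derivation_inverse[OF alg_derivation_ratD(1)] derivation_inverse[OF alg_derivation_ratD(2)])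
          (simp add: field_simps)
    qed
  qed
  moreover have "ratX \<in> ?S" "ratY \<in> ?S" by (simp_all add: \<phi>.zero \<phi>.one)
  ultimately show ?thesis using ratfun_mem_subfield by blast
qed

section \<open>The isomorphisms\<close>

definition ratJ :: "'a :: field_char_0 ratfun2 \<Rightarrow> 'a ratfun2 \<Rightarrow> 'a ratfun2" where
  "ratJ g h = ratDX g * ratDY h - ratDY g * ratDX h"

lemma poisson_bracket_ratJ: "poisson_bracket f g h = ratJ g h * f"
  by (simp add: poisson_bracket_def ratJ_def)

text \<open>Both isomorphisms to be constructed are substitutions of order two. Bijectivity then
  follows by checking generators, and the chain rule reduces the bracket condition to the value of
  \<phi> on \<open>f\<close>.\<close>

lemma poisson_isomorphic_by_involution:
  fixes f f' :: "'a :: field_char_0 ratfun2"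
  assumes J: "ratJ a b \<noteq> 0"
    and inv: "\<And>\<phi>. field_hom \<phi> \<Longrightarrow> (\<And>k. \<phi> (ratconst k) = ratconst k) \<Longrightarrow> \<phi> ratX = a \<Longrightarrow> \<phi> ratY = b \<Longrightarrow>
      \<phi> a = ratX \<and> \<phi> b = ratY \<and> \<phi> f = ratJ a b * f'"
  shows "poisson_bracket f \<cong>\<^sub>P poisson_bracket f'"
proof -
  have "ratDX a * ratDY b - ratDX b * ratDY a \<noteq> 0"
    using J by (simp add: ratJ_def mult.commute)
  then obtain \<phi> where \<phi>: "field_hom \<phi>" "\<And>k. \<phi> (ratconst k) = ratconst k" "\<phi> ratX = a" "\<phi> ratY = b"
    using ratfun_hom_exists[OF comm_ring_hom_ratconst alg_derivation_ratD, of a b] by metis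
  interpret \<phi>: field_hom \<phi> by fact
  note * = inv[OF \<phi>]
  have invol: "\<phi> (\<phi> g) = g" for g
  proof -
    have "subfield_over ratconst {g. \<phi> (\<phi> g) = g}"
      unfolding subfield_over_def by (auto simp: \<phi>.add \<phi>.mult \<phi>.inverse \<phi>(2))
    moreover have "ratX \<in> {g. \<phi> (\<phi> g) = g}" "ratY \<in> {g. \<phi> (\<phi> g) = g}"
      using * \<phi> by simp_all
    ultimately have "g \<in> {g. \<phi> (\<phi> g) = g}" by (rule ratfun_mem_subfield)
    then show ?thesis by simp
  qed
  have chain: "ratDX (\<phi> g) = \<phi> (ratDX g) * ratDX a + \<phi> (ratDY g) * ratDX b"
    "ratDY (\<phi> g) = \<phi> (ratDX g) * ratDY a + \<phi> (ratDY g) * ratDY b" for g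
    using derivation_chain_rule[OF \<phi>(1,2) alg_derivation_ratD(1)]
      derivation_chain_rule[OF \<phi>(1,2) alg_derivation_ratD(2)] by (simp_all add: \<phi>(3,4))
  have "poisson_isomorphism (poisson_bracket f) (poisson_bracket f') \<phi>"
    unfolding poisson_isomorphism_def
  proof (intro conjI allI)
    show "bij \<phi>" by (rule o_bij[of \<phi>]) (auto simp: invol)
    show "\<phi> (poisson_bracket f g h) = poisson_bracket f' (\<phi> g) (\<phi> h)" for g h
      by (simp add: poisson_bracket_ratJ \<phi>.mult * ratJ_def chain \<phi>.diff) (simp add: algebra_simps)
  qed (simp_all add: \<phi>.add \<phi>.mult \<phi>(2))
  then show ?thesis unfolding poisson_isomorphic_def by blast
qed

lemma K_Weyl_iso_K_1_0: "(K_Weyl :: 'a :: field_char_0 ratfun2 \<Rightarrow> _) \<cong>\<^sub>P K_1_0 1"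
proof -
  have X: "ratX \<noteq> (0 :: 'a ratfun2)" and Y: "ratY \<noteq> (0 :: 'a ratfun2)"
    by (simp_all add: ratX_def ratY_def)
  \<comment> \<open>The substitution x -> -1/(xy), y -> y is its own inverse, and its Jacobian
    1/(x^2 y) cancels the factor x^2 y of the target bracket.\<close>
  let ?a = "- inverse (ratX * ratY) :: 'a ratfun2"
  have "ratX * ratY \<noteq> (0 :: 'a ratfun2)" using X Y by simp
  then have "ratDX ?a = ratY / (ratX * ratY)\<^sup>2"
    unfolding derivation_uminus[OF alg_derivation_ratD(1)]
    by (subst derivation_inverse[OF alg_derivation_ratD(1)]) (simp_all add: ratDX_simps)
  then have "ratDX ?a = inverse (ratX\<^sup>2 * ratY)"
    using X Y by (simp add: field_simps power2_eq_square)
  then have J: "ratJ ?a ratY = inverse (ratX\<^sup>2 * ratY)"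
    by (simp add: ratJ_def)
  show ?thesis
    unfolding K_Weyl_def K_1_0_def
  proof (rule poisson_isomorphic_by_involution)
    show "ratJ ?a ratY \<noteq> 0"
      unfolding J using X Y by simp
    fix \<phi> :: "'a ratfun2 \<Rightarrow> 'a ratfun2"
    assume "field_hom \<phi>" and \<phi>: "\<phi> ratX = ?a" "\<phi> ratY = ratY"
    then interpret \<phi>: field_hom \<phi> by simp
    show "\<phi> ?a = ratX \<and> \<phi> ratY = ratY \<and> \<phi> 1 = ratJ ?a ratY * (ratX ^ (1 + 1) * ratY)"
      unfolding J using X Y
      by (simp add: \<phi>.inverse \<phi>.mult \<phi>.uminus \<phi>.one \<phi>) (simp add: field_simps power2_eq_square)
  qed
qed

lemma ratconst_eq_0_iff [simp]: "ratconst c = 0 \<longleftrightarrow> c = 0"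
  by (simp add: ratconst_def)

text \<open>Interchanging x and y fixes xy and has Jacobian -1.\<close>

lemma K_q_iso_neg: "K_q q \<cong>\<^sub>P K_q (- q)"
proof -
  have J: "ratJ ratY ratX = (- 1 :: 'a ratfun2)"
    by (simp add: ratJ_def)
  show ?thesis
    unfolding K_q_def
  proof (rule poisson_isomorphic_by_involution)
    show "ratJ ratY ratX \<noteq> (0 :: 'a ratfun2)" unfolding J by simp
  next
    fix \<phi> :: "'a ratfun2 \<Rightarrow> 'a ratfun2"
    assume "field_hom \<phi>" and \<phi>: "\<phi> ratX = ratY" "\<phi> ratY = ratX" "\<And>k. \<phi> (ratconst k) = ratconst k"
    then interpret \<phi>: field_hom \<phi> by simp
    show "\<phi> ratY = ratX \<and> \<phi> ratX = ratY \<and>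
        \<phi> (ratconst q * ratX * ratY) = ratJ ratY ratX * (ratconst (- q) * ratX * ratY)"
      unfolding J by (simp add: \<phi>.mult \<phi> comm_ring_hom.uminus[OF comm_ring_hom_ratconst])
  qed
qed

unbundle fps_syntax

section \<open>Iterated Laurent series\<close>

text \<open>Arbitrary lower bounds in place of subdegrees let a series and its coefficientwise
  derivative share one summation range.\<close>

lemma fls_times_nth_bounded:
  fixes f g :: "'a :: semiring_0 fls"
  assumes f: "\<And>i. i < a \<Longrightarrow> f $$ i = 0" and g: "\<And>i. i < b \<Longrightarrow> g $$ i = 0"
  shows "(f * g) $$ n = (\<Sum>i=a..n-b. f $$ i * g $$ (n - i))"
proof (cases "f = 0 \<or> g = 0")
  case False
  then have "a \<le> fls_subdegree f" "b \<le> fls_subdegree g"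
    using f g by (auto intro!: fls_subdegree_geI)
  then show ?thesis
    unfolding fls_times_nth(2) by (intro sum.mono_neutral_left) auto
qed auto

text \<open>This is d/dx on k((x))((y)): the outer variable is y, and the coefficients are series in
  x.\<close>

definition fls_coeff_deriv :: "'a :: ring_1 fls fls \<Rightarrow> 'a fls fls" where
  "fls_coeff_deriv f = Abs_fls (\<lambda>n. fls_deriv (f $$ n))"

lemma fls_coeff_deriv_nth [simp]: "fls_coeff_deriv f $$ n = fls_deriv (f $$ n)"
  unfolding fls_coeff_deriv_def
  by (rule nth_Abs_fls_lower_bound[of "fls_subdegree f"]) simp

lemma fls_coeff_deriv_mult:
  "fls_coeff_deriv (f * g) = f * fls_coeff_deriv g + fls_coeff_deriv f * g"
proof (rule fls_eqI)
  fix n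
  define a where "a = fls_subdegree f"
  define b where "b = fls_subdegree g"
  have [simp]: "f $$ i = 0" if "i < a" for i using that by (simp add: a_def)
  have [simp]: "g $$ i = 0" if "i < b" for i using that by (simp add: b_def)
  note times = fls_times_nth_bounded[of a _ b]
  show "fls_coeff_deriv (f * g) $$ n = (f * fls_coeff_deriv g + fls_coeff_deriv f * g) $$ n"
    by (simp add: times fls_deriv_sum sum.distrib)
qed

abbreviation fls2_const :: "'a :: zero \<Rightarrow> 'a fls fls" where
  "fls2_const k \<equiv> fls_const (fls_const k)"

lemma comm_ring_hom_fls2_const: "comm_ring_hom (fls2_const :: 'a :: field_char_0 \<Rightarrow> _)"
  by standard (simp_all flip: fls_plus_const fls_const_mult_const)

lemma alg_derivation_fls:
  "alg_derivation (fls2_const :: 'a :: field_char_0 \<Rightarrow> _) fls_coeff_deriv"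
  "alg_derivation (fls2_const :: 'a :: field_char_0 \<Rightarrow> _) (\<lambda>f. fls_X * fls_deriv f)"
  "alg_derivation (fls2_const :: 'a :: field_char_0 \<Rightarrow> _) fls_deriv"
proof -
  have [simp]: "fls_coeff_deriv (f + g) = fls_coeff_deriv f + fls_coeff_deriv g"
    "fls_coeff_deriv (fls2_const k) = 0" for f g :: "'a fls fls" and k
    by (rule fls_eqI; simp)+
  show "alg_derivation (fls2_const :: 'a \<Rightarrow> _) fls_coeff_deriv"
    "alg_derivation (fls2_const :: 'a \<Rightarrow> _) (\<lambda>f. fls_X * fls_deriv f)"
    "alg_derivation (fls2_const :: 'a \<Rightarrow> _) fls_deriv"
    unfolding alg_derivation_def by (simp_all add: fls_coeff_deriv_mult algebra_simps)
qed

section \<open>Leading coefficients of Laurent series\<close>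

definition fls_lead :: "'a :: zero fls \<Rightarrow> 'a" where
  "fls_lead f = f $$ fls_subdegree f"

lemma fls_lead_eq_0_iff [simp]: "fls_lead f = 0 \<longleftrightarrow> f = 0"
  by (simp add: fls_lead_def nth_fls_subdegree_zero_iff)

lemma fls_lead_mult: "fls_lead (f * g) = fls_lead f * fls_lead g" for f g :: "'a :: idom fls"
  by (cases "f = 0 \<or> g = 0")
    (auto simp: fls_lead_def fls_times_nth_bounded[where a = "fls_subdegree f" and b = "fls_subdegree g"])

lemma fls_lead_inverse: "fls_lead (inverse f) = inverse (fls_lead f)" for f :: "'a :: field fls"
proof (cases "f = 0")
  case False
  then have "fls_lead (inverse f) * fls_lead f = 1"
    unfolding fls_lead_mult[symmetric] by (simp add: fls_lead_def)
  then show ?thesis by (metis inverse_unique mult.commute)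
qed (simp add: fls_lead_def)

lemma fls_lead_power: "fls_lead (f ^ n) = fls_lead f ^ n" for f :: "'a :: idom fls"
  by (induction n) (simp_all add: fls_lead_mult, simp add: fls_lead_def)

lemma fls_lead_power_int: "fls_lead (f powi n) = fls_lead f powi n" for f :: "'a :: field fls"
  by (simp add: power_int_def fls_lead_power fls_lead_inverse)

lemma fls_times_nth_0:
  fixes f g :: "'a :: semiring_0 fls"
  assumes "fls_subdegree f \<ge> 0" "fls_subdegree g \<ge> 0"
  shows "(f * g) $$ 0 = f $$ 0 * g $$ 0"
  using fls_times_nth_bounded[of 0 f 0 g 0] assms by simp

text \<open>The inverse of \<open>f\<close> starts in degree minus the order of \<open>f\<close>, so
  a numerator starting no earlier than \<open>f\<close> gives a power series. It is applied to
  derivatives of \<open>f\<close> that do not lower the order.\<close>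

lemma fls_divide_ge:
  fixes f h :: "'a :: field fls"
  assumes "f \<noteq> 0" "\<And>i. i < fls_subdegree f \<Longrightarrow> h $$ i = 0"
  shows "fls_subdegree (h / f) \<ge> 0" "(h / f) $$ 0 = h $$ fls_subdegree f / fls_lead f"
proof -
  have *: "(h / f) $$ n = (\<Sum>i=fls_subdegree f..n + fls_subdegree f. h $$ i * inverse f $$ (n - i))" for n
    unfolding field_class.field_divide_inverse
    using assms fls_times_nth_bounded[of "fls_subdegree f" h "- fls_subdegree f" "inverse f" n] by simp
  show "fls_subdegree (h / f) \<ge> 0" by (rule fls_subdegree_ge0I) (simp add: *)
  show "(h / f) $$ 0 = h $$ fls_subdegree f / fls_lead f"
    using fls_lead_inverse[of f]
    unfolding *[of 0] by (simp add: fls_lead_def field_class.field_divide_inverse)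
qed

section \<open>Logarithmic derivatives and the form dlog f \<and> dlog g\<close>

definition logDX :: "'a :: field_char_0 fls fls \<Rightarrow> 'a fls fls" where
  "logDX f = fls_coeff_deriv f / f"

definition logDY :: "'a :: field_char_0 fls fls \<Rightarrow> 'a fls fls" where
  "logDY f = fls_X * fls_deriv f / f"

lemma logDX_mult: "f \<noteq> 0 \<Longrightarrow> g \<noteq> 0 \<Longrightarrow> logDX (f * g) = logDX f + logDX g"
  by (simp add: logDX_def fls_coeff_deriv_mult add_divide_distrib)

lemma logDY_mult: "f \<noteq> 0 \<Longrightarrow> g \<noteq> 0 \<Longrightarrow> logDY (f * g) = logDY f + logDY g"
  by (simp add: logDY_def add_divide_distrib distrib_left)

lemma logDX_power_int: "f \<noteq> 0 \<Longrightarrow> logDX (f powi n) = of_int n * logDX f"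
  by (simp add: logDX_def derivation_power_int[OF alg_derivation_fls(1)])

lemma logDY_power_int: "f \<noteq> 0 \<Longrightarrow> logDY (f powi n) = of_int n * logDY f"
  by (simp add: logDY_def derivation_power_int[OF alg_derivation_fls(2)])

lemma logDX_nonneg:
  assumes "f \<noteq> 0"
  shows "fls_subdegree (logDX f) \<ge> 0" "logDX f $$ 0 = fls_deriv (fls_lead f) / fls_lead f"
  unfolding logDX_def using fls_divide_ge[of f "fls_coeff_deriv f"] assms by (auto simp: fls_lead_def)

lemma logDY_nonneg:
  assumes "f \<noteq> 0"
  shows "fls_subdegree (logDY f) \<ge> 0" "logDY f $$ 0 = of_int (fls_subdegree f)"
  unfolding logDY_def using fls_divide_ge[of f "fls_X * fls_deriv f"] assms
  by (auto simp: fls_lead_def fls_X_times_conv_shift)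

text \<open>As dlog f = \<open>logDX f\<close> dx + \<open>logDY f\<close> dlog y, this is the
  coefficient of dx \<and> dlog y in dlog f \<and> dlog g.\<close>

definition logJ :: "'a :: field_char_0 fls fls \<Rightarrow> 'a fls fls \<Rightarrow> 'a fls fls" where
  "logJ f g = logDX f * logDY g - logDY f * logDX g"

text \<open>The constant terms of \<open>logDX\<close> and \<open>logDY\<close> are the logarithmic
  derivative of the leading coefficient and the order in y. Up to sign, \<open>logJ f g $$ 0\<close>
  is thus the residue of the form along y = 0.\<close>

lemma logJ_lead:
  assumes "f \<noteq> 0" "g \<noteq> 0"
  shows "fls_subdegree (logJ f g) \<ge> 0"
    "logJ f g $$ 0 = of_int (fls_subdegree g) * (fls_deriv (fls_lead f) / fls_lead f) -
      of_int (fls_subdegree f) * (fls_deriv (fls_lead g) / fls_lead g)"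
proof -
  show "fls_subdegree (logJ f g) \<ge> 0"
  proof (rule fls_subdegree_ge0I)
    fix k :: int
    assume "k < 0"
    moreover have "fls_subdegree (logDX f * logDY g) \<ge> 0" "fls_subdegree (logDY f * logDX g) \<ge> 0"
      by (intro fls_mult_subdegree_ge_0 logDX_nonneg logDY_nonneg assms)+
    ultimately show "logJ f g $$ k = 0" by (simp add: logJ_def)
  qed
  show "logJ f g $$ 0 = of_int (fls_subdegree g) * (fls_deriv (fls_lead f) / fls_lead f) -
      of_int (fls_subdegree f) * (fls_deriv (fls_lead g) / fls_lead g)"
    unfolding logJ_def using assms by (simp add: logDX_nonneg logDY_nonneg fls_times_nth_0)
qed

text \<open>The form is bilinear and alternating in dlog w and dlog u, so a monomial change of
  coordinates contributes the determinant of its exponents.\<close>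

lemma logJ_monomials:
  assumes "w \<noteq> 0" "u \<noteq> 0"
  shows "logJ (w powi r * u powi s) (w powi t * u powi v) = of_int (r * v - s * t) * logJ w u"
  using assms by (simp add: logJ_def logDX_mult logDY_mult logDX_power_int logDY_power_int algebra_simps)

text \<open>Translation by a constant leaves du = u dlog u unchanged.\<close>

lemma logJ_diff_const:
  assumes "u \<noteq> 0" "u \<noteq> fls2_const k"
  shows "logJ w (u - fls2_const k) * (u - fls2_const k) = logJ w u * u"
proof -
  have "fls_coeff_deriv (u - fls2_const k) = fls_coeff_deriv u"
    by (simp add: derivation_diff[OF alg_derivation_fls(1)] alg_derivationD(3)[OF alg_derivation_fls(1)])
  then have "logDX (u - fls2_const k) * (u - fls2_const k) = logDX u * u"
    "logDY (u - fls2_const k) * (u - fls2_const k) = logDY u * u"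
    using assms by (simp_all add: logDX_def logDY_def)
  moreover have "logJ w v * v = logDX w * (logDY v * v) - logDY w * (logDX v * v)" for v
    by (simp add: logJ_def algebra_simps)
  ultimately show ?thesis by simp
qed

text \<open>Expansion of rational functions in k((x))((y)); it exists because x and y have Jacobian
  1 there, and the chain rule makes it commute with the partial derivatives.\<close>

lemma ratfun_fls_hom:
  obtains \<iota> :: "'a :: field_char_0 ratfun2 \<Rightarrow> 'a fls fls"
  where "field_hom \<iota>" "\<And>k. \<iota> (ratconst k) = fls2_const k" "\<iota> ratX = fls_const fls_X" "\<iota> ratY = fls_X"
    "\<And>g. fls_coeff_deriv (\<iota> g) = \<iota> (ratDX g)" "\<And>g. fls_deriv (\<iota> g) = \<iota> (ratDY g)"
proof -
  have D: "fls_coeff_deriv (fls_const fls_X) = (1 :: 'a fls fls)" "fls_coeff_deriv fls_X = (0 :: 'a fls fls)"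
  proof -
    have "fls_coeff_deriv (fls_const fls_X) = fls_const (fls_deriv (fls_X :: 'a fls))"
      by (rule fls_eqI) simp
    then show "fls_coeff_deriv (fls_const fls_X) = (1 :: 'a fls fls)" by simp
    show "fls_coeff_deriv fls_X = (0 :: 'a fls fls)"
      by (rule fls_eqI) simp
  qed
  then have "fls_coeff_deriv (fls_const fls_X) * fls_deriv fls_X -
      fls_coeff_deriv fls_X * fls_deriv (fls_const fls_X) \<noteq> (0 :: 'a fls fls)"
    by simp
  from ratfun_hom_exists[OF comm_ring_hom_fls2_const alg_derivation_fls(1,3) this]
  obtain \<iota> :: "'a ratfun2 \<Rightarrow> 'a fls fls" where \<iota>: "field_hom \<iota>" "\<And>k. \<iota> (ratconst k) = fls2_const k"
    "\<iota> ratX = fls_const fls_X" "\<iota> ratY = fls_X"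
    by metis
  note chain = derivation_chain_rule[OF \<iota>(1,2) alg_derivation_fls(1)]
    derivation_chain_rule[OF \<iota>(1,2) alg_derivation_fls(3)]
  show thesis
    using that[OF \<iota>] chain unfolding \<iota>(3,4) by (simp add: D)
qed

text \<open>The factor y comes from dy = y dlog y.\<close>

lemma ratfun_hom_logJ:
  assumes "field_hom \<iota>" "\<And>g. fls_coeff_deriv (\<iota> g) = \<iota> (ratDX g)" "\<And>g. fls_deriv (\<iota> g) = \<iota> (ratDY g)"
    "\<iota> ratY = fls_X" "g \<noteq> 0" "h \<noteq> 0"
  shows "logJ (\<iota> g) (\<iota> h) = \<iota> (ratY * ratJ g h / (g * h))"
proof -
  interpret \<iota>: field_hom \<iota> by fact
  have "\<iota> g \<noteq> 0" "\<iota> h \<noteq> 0" using assms by (simp_all add: \<iota>.eq_0_iff)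
  then show ?thesis
    by (simp add: logJ_def logDX_def logDY_def assms(2-4) ratJ_def \<iota>.mult \<iota>.divide \<iota>.diff field_simps)
qed

section \<open>Obstructions from residues\<close>

text \<open>The identity for \<open>ratJ\<close> says that \<phi> carries the form dx \<and> dy / f
  to dx \<and> dy / f'.\<close>

lemma poisson_isomorphismD:
  assumes "poisson_isomorphism (poisson_bracket f) (poisson_bracket f') \<phi>"
  shows "field_hom \<phi>" "\<phi> (ratconst k) = ratconst k"
    "ratJ (\<phi> ratX) (\<phi> ratY) * f' = \<phi> f" "\<phi> ratX \<noteq> 0" "\<phi> ratY \<noteq> 0" "bij \<phi>"
proof -
  note * = assms[unfolded poisson_isomorphism_def]
  have 1: "\<phi> 1 = 1"
    using * comm_ring_hom.one[OF comm_ring_hom_ratconst] by metis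
  show \<phi>: "field_hom \<phi>"
    using * 1 by unfold_locales blast+
  show "\<phi> (ratconst k) = ratconst k" "bij \<phi>" using * by blast+
  show "ratJ (\<phi> ratX) (\<phi> ratY) * f' = \<phi> f"
    using * poisson_bracket_ratX_ratY[of f] by (metis poisson_bracket_ratJ)
  show "\<phi> ratX \<noteq> 0" "\<phi> ratY \<noteq> 0"
    by (simp_all add: field_hom.eq_0_iff[OF \<phi>] ratX_def ratY_def)
qed

text \<open>The images F and G of x and y satisfy dlog F \<and> dlog G = (q/q') dlog x \<and> dlog
  y, and the left side has integer residue.\<close>

lemma K_q_iso_integer_multiple:
  fixes q q' :: "'a :: field_char_0"
  assumes "K_q q \<cong>\<^sub>P K_q q'" and q': "q' \<noteq> 0"
  obtains N :: int where "q = of_int N * q'"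
proof -
  obtain \<phi> :: "'a ratfun2 \<Rightarrow> 'a ratfun2" where "poisson_isomorphism (K_q q) (K_q q') \<phi>"
    using assms unfolding poisson_isomorphic_def by blast
  note \<phi> = poisson_isomorphismD[OF this[unfolded K_q_def]]
  interpret \<phi>: field_hom \<phi> by (fact \<phi>)
  obtain \<iota> :: "'a ratfun2 \<Rightarrow> 'a fls fls" where \<iota>: "field_hom \<iota>" "\<And>k. \<iota> (ratconst k) = fls2_const k"
    "\<iota> ratX = fls_const fls_X" "\<iota> ratY = fls_X"
    "\<And>g. fls_coeff_deriv (\<iota> g) = \<iota> (ratDX g)" "\<And>g. fls_deriv (\<iota> g) = \<iota> (ratDY g)"
    by (rule ratfun_fls_hom) blast
  interpret \<iota>: field_hom \<iota> by (fact \<iota>)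
  define F where "F = \<iota> (\<phi> ratX)"
  define G where "G = \<iota> (\<phi> ratY)"
  have FG: "F \<noteq> 0" "G \<noteq> 0"
    using \<phi>(4,5) by (simp_all add: F_def G_def \<iota>.eq_0_iff)
  have "ratY * ratJ (\<phi> ratX) (\<phi> ratY) / (\<phi> ratX * \<phi> ratY) * (ratconst q' * ratX) =
      (ratJ (\<phi> ratX) (\<phi> ratY) * (ratconst q' * ratX * ratY)) / (\<phi> ratX * \<phi> ratY)"
    by simp
  also have "\<dots> = ratconst q"
    unfolding \<phi>(3) using \<phi>(4,5) by (simp add: \<phi>.mult \<phi>(2))
  finally have "logJ F G * (fls2_const q' * fls_const fls_X) = fls2_const q"
    unfolding F_def G_def ratfun_hom_logJ[OF \<iota>(1,5,6,4) \<phi>(4,5)] by (metis \<iota>.mult \<iota>(2,3))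
  then have "logJ F G * fls_const (fls_const q' * fls_X) = fls2_const q"
    by (simp add: fls_const_mult_const)
  from arg_cong[OF this, of "\<lambda>f. f $$ 0"]
  have "(logJ F G $$ 0) * (fls_const q' * fls_X) = fls_const q"
    by simp
  then have "(logJ F G $$ 0) * fls_X = fls_const (q / q')"
  proof -
    assume *: "(logJ F G $$ 0) * (fls_const q' * fls_X) = fls_const q"
    have "(logJ F G $$ 0) * fls_X =
        fls_const (inverse q') * ((logJ F G $$ 0) * (fls_const q' * fls_X))"
      using q' by (simp add: mult.left_commute[of _ "fls_const q'"] flip: mult.assoc)
    also have "\<dots> = fls_const (q / q')"
      unfolding * by (simp add: field_class.field_divide_inverse mult.commute)
    finally show ?thesis .
  qed
  from arg_cong[OF this, of "\<lambda>f. f $$ 0"]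
  have "logJ F G $$ 0 $$ -1 = q / q'"
    by (simp add: fls_X_times_conv_shift mult.commute)
  \<comment> \<open>The residue of dlog of a series in x is its order, so the residue is a
    determinant formed from the orders in y and the orders in x of the leading coefficients.\<close>
  moreover have "logJ F G $$ 0 $$ -1 =
      of_int (fls_subdegree G * fls_subdegree (fls_lead F) - fls_subdegree F * fls_subdegree (fls_lead G))"
    using fls_residue_deriv_times_inverse_eq_subdegree(1)[of "fls_lead F"]
      fls_residue_deriv_times_inverse_eq_subdegree(1)[of "fls_lead G"] FG
    by (simp add: logJ_lead fls_of_int field_class.field_divide_inverse)
  ultimately show thesis
    using that q' by (metis nonzero_eq_divide_eq)
qed

text \<open>Mapping into \<open>K_q q\<close> places the residue computation where the form is dlog
  x \<and> dlog y / q.\<close>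

lemma K_q_not_iso_K_1_0:
  fixes q :: "'a :: field_char_0"
  assumes q: "q \<noteq> 0" and n: "n \<ge> 1"
  shows "\<not> K_1_0 n \<cong>\<^sub>P K_q q"
proof
  assume "K_1_0 n \<cong>\<^sub>P K_q q"
  then obtain \<phi> :: "'a ratfun2 \<Rightarrow> 'a ratfun2" where "poisson_isomorphism (K_1_0 n) (K_q q) \<phi>"
    unfolding poisson_isomorphic_def by blast
  note \<phi> = poisson_isomorphismD[OF this[unfolded K_1_0_def K_q_def]]
  interpret \<phi>: field_hom \<phi> by (fact \<phi>)
  obtain \<iota> :: "'a ratfun2 \<Rightarrow> 'a fls fls" where \<iota>: "field_hom \<iota>" "\<And>k. \<iota> (ratconst k) = fls2_const k"
    "\<iota> ratX = fls_const fls_X" "\<iota> ratY = fls_X"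
    "\<And>g. fls_coeff_deriv (\<iota> g) = \<iota> (ratDX g)" "\<And>g. fls_deriv (\<iota> g) = \<iota> (ratDY g)"
    by (rule ratfun_fls_hom) blast
  interpret \<iota>: field_hom \<iota> by (fact \<iota>)
  define g where "g = \<phi> ratX"
  define h where "h = \<phi> ratY"
  \<comment> \<open>Provides the primitive: d(Z dlog h) = -n g^(-n) dlog g \<and> dlog h.\<close>
  define Z where "Z = g powi (- int n)"
  have nz: "g \<noteq> 0" "h \<noteq> 0" using \<phi>(4,5) by (simp_all add: g_def h_def)
  have XY: "ratX \<noteq> (0 :: 'a ratfun2)" "ratY \<noteq> (0 :: 'a ratfun2)"
    by (simp_all add: ratX_def ratY_def)
  have J: "ratJ g h * (ratconst q * ratX * ratY) = g ^ (n + 1) * h"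
    using \<phi>(3) by (simp add: g_def h_def \<phi>.mult \<phi>.power)
  have Z: "ratDX Z = - of_nat n * Z * (ratDX g / g)" "ratDY Z = - of_nat n * Z * (ratDY g / g)"
    unfolding Z_def using derivation_power_int[OF alg_derivation_ratD(1) nz(1), of "- int n"]
      derivation_power_int[OF alg_derivation_ratD(2) nz(1), of "- int n"] by simp_all
  have "ratDX (Z * (ratDY h * inverse h)) - ratDY (Z * (ratDX h * inverse h)) =
      - of_nat n * (Z * ratJ g h / (g * h))"
    unfolding ratDX_simps ratDY_simps derivation_inverse[OF alg_derivation_ratD(1) nz(2)]
      derivation_inverse[OF alg_derivation_ratD(2) nz(2)] ratDX_ratDY Z ratJ_def
    using nz by (simp add: field_simps power2_eq_square)
  also have "Z * ratJ g h / (g * h) = inverse (ratconst q * ratX * ratY)"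
  proof -
    have "ratJ g h = g ^ (n + 1) * h * inverse (ratconst q * ratX * ratY)"
      using J q XY by (simp add: field_simps)
    then show ?thesis
      using nz by (simp add: Z_def power_int_minus)
  qed
  finally have "fls_coeff_deriv (\<iota> (Z * (ratDY h * inverse h))) - fls_deriv (\<iota> (Z * (ratDX h * inverse h))) =
      - of_nat n * inverse (fls2_const q * fls_const fls_X * fls_X)"
    unfolding \<iota>(5,6) \<iota>.diff[symmetric] by (simp add: \<iota>.uminus \<iota>.mult \<iota>.of_nat \<iota>.inverse \<iota>
        fls_inverse_const fls_inverse_X flip: fls_const_mult_const)
  \<comment> \<open>Neither a derivative in x nor one in y has a term x^(-1) y^(-1), whereas the
    right side has coefficient -n/q there.\<close>
  from arg_cong[OF this, of "\<lambda>f. f $$ -1 $$ -1"]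
  have "(of_nat n * inverse (fls2_const q * fls_const fls_X * fls_X)) $$ -1 $$ -1 = (0 :: 'a)"
    by simp
  moreover have "of_nat n * inverse (fls2_const q * fls_const fls_X * fls_X) =
      fls_const (fls_const (of_nat n / q) * fls_X_inv) * (fls_X_inv :: 'a fls fls)"
    by (simp add: fls_inverse_X fls_inverse_const fls_of_nat field_class.field_divide_inverse
        flip: fls_const_mult_const)
  ultimately have "(fls_const (fls_const (of_nat n / q) * fls_X_inv) * fls_X_inv) $$ -1 $$ -1 = (0 :: 'a)"
    by (simp only:)
  then show False
    using q n by simp
qed

section \<open>Fields generated by two elements\<close>

text \<open>A divisor of least positive degree is irreducible, and over a field irreducible
  polynomials are prime.\<close>

lemma exists_prime_divisor_poly:
  fixes A :: "'a :: field poly"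
  assumes "degree A \<ge> 1"
  obtains p where "prime_elem p" "p dvd A"
proof -
  define p where "p = arg_min degree (\<lambda>p. p dvd A \<and> degree p \<ge> 1)"
  have p: "p dvd A \<and> degree p \<ge> 1"
    unfolding p_def using assms arg_min_natI[of "\<lambda>p. p dvd A \<and> degree p \<ge> 1" A degree] by simp
  have min: "degree p \<le> degree d" if "d dvd A" "degree d \<ge> 1" for d
    unfolding p_def using that arg_min_nat_le[of "\<lambda>p. p dvd A \<and> degree p \<ge> 1" d degree] by simp
  have p0: "p \<noteq> 0" using p by auto
  have "irreducible p"
  proof (rule irreducibleI)
    show "p \<noteq> 0" by (fact p0)
    show "\<not> p dvd 1" using conjunct2[OF p] p0 by (simp add: is_unit_iff_degree)
    fix a b
    assume ab: "p = a * b"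
    then have nz: "a \<noteq> 0" "b \<noteq> 0" using p0 by auto
    have "a * b dvd A" using p ab by simp
    then have "a dvd A" "b dvd A" by (blast dest: dvd_mult_left dvd_mult_right)+
    have "degree p = degree a + degree b"
      unfolding ab using nz by (rule degree_mult_eq)
    then have "degree a = 0 \<or> degree b = 0"
      using min[OF \<open>a dvd A\<close>] min[OF \<open>b dvd A\<close>] by linarith
    then show "a dvd 1 \<or> b dvd 1" using nz by (simp add: is_unit_iff_degree)
  qed
  then show thesis
    using that[of p] p field_poly_irreducible_imp_prime[of p] by blast
qed

text \<open>
  For \<open>\<beta> \<noteq> 0\<close> the polynomial \<open>T\<^sup>j - \<beta>\<close> is squarefree, so up to a constant it is not an
  \<open>m\<close>-th power in \<open>k(T)\<close> unless \<open>m = 1\<close>.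
\<close>

lemma monom_minus_const_power:
  fixes P Q :: "'a :: field_char_0 poly"
  assumes j: "j \<ge> 1" and m: "m \<ge> 2" and \<beta>: "\<beta> \<noteq> 0" and \<alpha>: "\<alpha> \<noteq> 0"
    and eq: "(monom 1 j - [:\<beta>:]) * P ^ m = smult \<alpha> (Q ^ m)"
  shows "P = 0"
proof -
  define A where "A = monom 1 j - [:\<beta>:]"
  have "coeff A j = 1" using j by (simp add: A_def coeff_pCons split: nat.split)
  then have "degree A \<ge> 1" using j le_degree[of A j] by simp
  then obtain p where p: "prime_elem p" "p dvd A" by (rule exists_prime_divisor_poly)
  have nu: "\<not> p dvd 1" and p0: "p \<noteq> 0" using p(1) by (auto simp: prime_elem_def)
  obtain B where B: "A = p * B" using p(2) by blast
  \<comment> \<open>A double factor \<open>p\<close> would divide the derivative j T^(j-1), hence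
    T^j and the constant \<beta>.\<close>
  have nB: "\<not> p dvd B"
  proof
    assume "p dvd B"
    then obtain C where C: "A = p * (p * C)" using B by blast
    then have "pderiv A = p * (pderiv (p * C) + C * pderiv p)"
      by (simp add: pderiv_mult algebra_simps)
    moreover have "pderiv A = smult (of_nat j) (monom 1 (j - 1))"
      by (simp add: A_def pderiv_diff pderiv_monom smult_monom pderiv_pCons)
    ultimately have "p dvd smult (of_nat j) (monom 1 (j - 1))" by (metis dvd_triv_left)
    then have "p dvd monom 1 (j - 1)" using j by (simp add: dvd_smult_iff)
    then have "p dvd monom 1 1 * monom 1 (j - 1)" by (rule dvd_mult)
    then have "p dvd monom 1 j" using j by (simp add: mult_monom)
    then have "p dvd monom 1 j - A" using p(2) by (rule dvd_diff)
    then have "p dvd [:\<beta>:]" by (simp add: A_def)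
    then show False using nu \<beta> dvd_trans[of p "[:\<beta>:]" 1] by (simp add: is_unit_const_poly_iff dvd_field_iff)
  qed
  from eq have "A * P ^ m = smult \<alpha> (Q ^ m)" by (simp add: A_def)
  then show ?thesis
  \<comment> \<open>The multiplicity of \<open>p\<close> is 1 modulo \<open>m\<close> on the left
    and 0 on the right; this is run as a descent dividing both \<open>P\<close> and \<open>Q\<close>
    by \<open>p\<close>.\<close>
  proof (induction "degree P" arbitrary: P Q rule: less_induct)
    case less
    have "p dvd smult \<alpha> (Q ^ m)"
      unfolding less.prems[symmetric] using p(2) by (rule dvd_mult2)
    then have "p dvd Q" using \<alpha> p(1) by (metis dvd_smult_iff prime_elem_dvd_power)
    then obtain Q' where Q': "Q = p * Q'" by blast
    \<comment> \<open>As \<open>m\<close> is at least 2, a factor \<open>p\<close> remains on the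
      right after cancelling the one in \<open>A\<close>, and it must divide
      \<open>P\<close>.\<close>
    obtain k where k: "m = Suc (Suc k)" using m by (metis Suc_le_D numeral_2_eq_2 Suc_le_mono)
    have "p * (B * P ^ m) = p * (p * (p ^ k * smult \<alpha> (Q' ^ m)))"
      using less.prems by (simp add: B Q' k power_mult_distrib algebra_simps)
    then have "B * P ^ m = p * (p ^ k * smult \<alpha> (Q' ^ m))"
      using p0 by (simp only: mult_cancel_left simp_thms)
    then have "p dvd B * P ^ m" by (metis dvd_triv_left)
    then have "p dvd P" using nB p(1) by (metis prime_elem_dvd_mult_iff prime_elem_dvd_power)
    then obtain P' where P': "P = p * P'" by blast
    have "p ^ m * (A * P' ^ m) = p ^ m * smult \<alpha> (Q' ^ m)"
      using less.prems by (simp add: P' Q' power_mult_distrib algebra_simps)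
    then have eq': "A * P' ^ m = smult \<alpha> (Q' ^ m)"
      using p0 by (simp only: mult_cancel_left power_not_zero simp_thms)
    show ?case
    proof (rule ccontr)
      assume "P \<noteq> 0"
      then have "P' \<noteq> 0" using P' by auto
      moreover have "degree p \<ge> 1" using nu p0 by (simp add: is_unit_iff_degree Suc_le_eq)
      ultimately have "degree P' < degree P" using p0 by (simp add: P' degree_mult_eq)
      from less.hyps[OF this eq'] \<open>P' \<noteq> 0\<close> show False by simp
    qed
  qed
qed

section \<open>Transcendental Laurent series and the residue field\<close>

lemma comm_ring_hom_fls_const: "comm_ring_hom (fls_const :: 'a :: comm_ring_1 \<Rightarrow> _)"
  by standard (simp_all flip: fls_plus_const)

text \<open>One-variable analogue of the Jacobian criterion: a nonconstant Laurent series is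
  transcendental over k.\<close>

lemma poly_hom_fls_const_eq_0:
  fixes U :: "'a :: field_char_0 fls"
  assumes U: "fls_deriv U \<noteq> 0" and p: "poly_hom fls_const U p = 0"
  shows "p = 0"
  using p
proof (induction "degree p" arbitrary: p rule: less_induct)
  case less
  interpret c: comm_ring_hom "fls_const :: 'a \<Rightarrow> _" by (rule comm_ring_hom_fls_const)
  have "fls_deriv (poly_hom fls_const U q) = poly_hom fls_const U (pderiv q) * fls_deriv U" for q
    by (induction q) (simp_all add: c.poly_hom_0 c.poly_hom_pCons c.poly_hom_add pderiv_pCons algebra_simps)
  from this[of p] have "poly_hom fls_const U (pderiv p) = 0"
    using less.prems U by simp
  then have "pderiv p = 0"
    using less.hyps[of "pderiv p"] by (cases "degree p = 0") (auto simp: degree_pderiv pderiv_eq_0_iff)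
  then obtain k where "p = [:k:]" by (metis degree_eq_zeroE pderiv_eq_0_iff)
  then show ?case using less.prems by (simp add: c.poly_hom_0 c.poly_hom_pCons)
qed

text \<open>Substituting x = P(U)/Q(U) gives (T^j - \<beta>) P^m = \<alpha> Q^m. For
  \<open>m\<close> at least 2 this forces \<beta> = 0; then orders at T = 0 give that m divides j,
  and orders in x that j divides m.\<close>

lemma power_parametrization:
  fixes U :: "'a :: field_char_0 fls"
  assumes m: "m \<ge> 1" and j: "j \<ge> 1" and \<alpha>: "\<alpha> \<noteq> 0"
    and U: "U ^ j = fls_const \<alpha> * fls_X_inv ^ m + fls_const \<beta>"
    and Q: "Q \<noteq> 0" and PQ: "poly_hom fls_const U P = fls_X * poly_hom fls_const U Q"
  shows "m = 1 \<or> m = j"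
proof (cases "m = 1")
  case False
  interpret c: comm_ring_hom "fls_const :: 'a \<Rightarrow> _" by (rule comm_ring_hom_fls_const)
  interpret ev: comm_ring_hom "poly_hom fls_const U" by (rule c.comm_ring_hom_poly_hom)
  have "fls_subdegree (U ^ j) = - int m"
    unfolding U using m \<alpha> by (intro fls_subdegree_eqI) (auto simp: fls_X_inv_power_conv_shift_1)
  then have v: "int j * fls_subdegree U = - int m" by (simp add: fls_subdegree_pow)
  have "fls_deriv U \<noteq> 0"
  proof
    assume "fls_deriv U = 0"
    then have "fls_subdegree U = 0" by (metis fls_deriv_eq_0_iff fls_const_subdegree)
    with v m show False by simp
  qed
  then have inj: "p = 0" if "poly_hom fls_const U p = 0" for p
    using poly_hom_fls_const_eq_0 that by blast
  have T: "poly_hom fls_const U (monom 1 k) = U ^ k" for k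
    by (simp add: poly_hom_def map_poly_monom poly_monom)
  have C: "poly_hom fls_const U [:k:] = fls_const k" for k
    by (simp add: c.poly_hom_pCons c.poly_hom_0)
  have "poly_hom fls_const U ((monom 1 j - [:\<beta>:]) * P ^ m - smult \<alpha> (Q ^ m)) =
      fls_const \<alpha> * (fls_X_inv ^ m * (fls_X * poly_hom fls_const U Q) ^ m) -
      fls_const \<alpha> * poly_hom fls_const U Q ^ m"
    by (simp add: ev.diff ev.mult ev.power c.poly_hom_smult T C U PQ left_diff_distrib distrib_right
        power_mult_distrib mult.assoc)
  also have "\<dots> = 0"
  proof -
    have "fls_X_inv * fls_X = (1 :: 'a fls)"
      by (metis fls_inverse_X fls_X_nonzero left_inverse)
    then show ?thesis by (simp add: mult.assoc[symmetric] flip: power_mult_distrib)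
  qed
  finally have eq: "(monom 1 j - [:\<beta>:]) * P ^ m = smult \<alpha> (Q ^ m)"
    using inj by (metis eq_iff_diff_eq_0)
  have P: "P \<noteq> 0" using eq \<alpha> Q m by (auto simp: power_0_left)
  then have "\<beta> = 0"
    using monom_minus_const_power[OF j _ _ \<alpha> eq] m False by (cases "\<beta> = 0") auto
  with eq have "monom 1 j * P ^ m = smult \<alpha> (Q ^ m)" by simp
  then have "order 0 (monom 1 j * P ^ m) = order 0 (smult \<alpha> (Q ^ m))" by simp
  moreover have "order 0 (R ^ k) = k * order 0 R" if "R \<noteq> 0" for R :: "'a poly" and k
    using that by (induction k) (simp_all add: order_mult)
  ultimately have "j + m * order 0 P = m * order 0 Q"
    using P Q \<alpha> by (simp add: order_mult order_smult)
  then have "m dvd j" by (metis dvd_add_left_iff dvd_triv_left)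
  moreover have "int j dvd int m" using v by (metis dvd_minus_iff dvd_triv_left)
  ultimately show ?thesis by (simp add: dvd_antisym)
qed simp

text \<open>
  On \<open>k(W, U)\<close> with \<open>ord W > 0\<close>, \<open>ord U = 0\<close> and the residue \<open>U\<^sub>0\<close> of \<open>U\<close> transcendental, the order
  is a monomial valuation with residue field \<open>k(U\<^sub>0)\<close>.
\<close>

lemma residue_in_generated_field:
  fixes W U :: "'a :: field_char_0 fls fls" and f :: "'a fls"
  assumes W: "fls_subdegree W > 0" and U: "fls_subdegree U = 0" and U0: "fls_deriv (U $$ 0) \<noteq> 0"
    and gen: "\<And>S. subfield_over fls2_const S \<Longrightarrow> W \<in> S \<Longrightarrow> U \<in> S \<Longrightarrow> fls_const f \<in> S"
    and f: "f \<noteq> 0"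
  obtains P Q where "Q \<noteq> 0" "poly_hom fls_const (U $$ 0) P = f * poly_hom fls_const (U $$ 0) Q"
proof -
  interpret c: comm_ring_hom "fls_const :: 'a \<Rightarrow> _" by (rule comm_ring_hom_fls_const)
  interpret c2: comm_ring_hom "fls2_const :: 'a \<Rightarrow> _" by (rule comm_ring_hom_fls2_const)
  interpret cU: comm_ring_hom "poly_hom fls2_const U" by (rule c2.comm_ring_hom_poly_hom)
  let ?E = "poly_hom (poly_hom fls2_const U) W"
  let ?e = "poly_hom fls_const (U $$ 0)"
  interpret E: comm_ring_hom ?E by (rule cU.comm_ring_hom_poly_hom)
  have add_ge0: "fls_subdegree (a + b) \<ge> 0" if "fls_subdegree a \<ge> 0" "fls_subdegree b \<ge> 0"
    for a b :: "'a fls fls"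
    using that by (intro fls_subdegree_ge0I) simp
  have coeffs: "fls_subdegree (poly_hom fls2_const U q) \<ge> 0 \<and> poly_hom fls2_const U q $$ 0 = ?e q" for q
    using U by (induction q) (simp_all add: c.poly_hom_0 c.poly_hom_pCons c2.poly_hom_0 c2.poly_hom_pCons
        add_ge0 fls_mult_subdegree_ge_0 fls_times_nth_0)
  have E0: "fls_subdegree (?E p) \<ge> 0 \<and> ?E p $$ 0 = ?e (coeff p 0)" for p
  proof (induction p)
    case (pCons q p)
    then show ?case
      using coeffs[of q] W by (simp add: cU.poly_hom_pCons add_ge0 fls_mult_subdegree_ge_0 fls_times_nth_0)
  qed (simp add: cU.poly_hom_0 c.poly_hom_0)
  have W0: "W \<noteq> 0" using W by auto
  have lead: "\<exists>i q. q \<noteq> 0 \<and> ?E p \<noteq> 0 \<and> fls_subdegree (?E p) = int i * fls_subdegree W \<and>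
      fls_lead (?E p) = fls_lead W ^ i * ?e q" if p: "p \<noteq> 0" for p
  proof -
    \<comment> \<open>The power of the outer variable split off becomes a power of \<open>W\<close>.
      The constant coefficient of \<open>r\<close> is nonzero and U_0 is transcendental, so the
      value of \<open>r\<close> has order 0.\<close>
    obtain r where r: "p = [:0, 1:] ^ order 0 p * r" "\<not> [:0, 1:] dvd r"
      using order_decomp[OF p, of 0] by auto
    have q: "coeff r 0 \<noteq> 0" using r(2) poly_eq_0_iff_dvd[of r 0] by (simp add: poly_0_coeff_0)
    then have "?E r $$ 0 \<noteq> 0" using E0 poly_hom_fls_const_eq_0[OF U0] by metis
    then have Er: "?E r \<noteq> 0" "fls_subdegree (?E r) = 0"
      using E0[of r] fls_subdegree_leI[of "?E r" 0] by auto
    have "?E [:0, 1:] = W"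
      by (simp add: cU.poly_hom_pCons cU.poly_hom_0 cU.zero cU.one)
    then have "?E p = W ^ order 0 p * ?E r"
      by (subst r(1)) (simp add: E.mult E.power)
    then show ?thesis
      using q Er W0 E0[of r] by (intro exI[of _ "order 0 p"] exI[of _ "coeff r 0"])
        (simp add: fls_subdegree_pow fls_lead_mult fls_lead_power, simp add: fls_lead_def)
  qed
  \<comment> \<open>The field k(W, U), with denominators cleared.\<close>
  define S where "S = {f. \<exists>P Q. ?E Q \<noteq> 0 \<and> f * ?E Q = ?E P}"
  have "subfield_over fls2_const S"
    unfolding subfield_over_def
  proof (intro conjI ballI subsetI)
    fix a b
    assume "a \<in> S" "b \<in> S"
    then obtain P Q P' Q' where *: "?E Q \<noteq> 0" "a * ?E Q = ?E P" "?E Q' \<noteq> 0" "b * ?E Q' = ?E P'"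
      unfolding S_def by blast
    have "(a + b) * ?E (Q * Q') = ?E (P * Q' + P' * Q)" "(a * b) * ?E (Q * Q') = ?E (P * P')"
      by (simp_all add: E.mult E.add flip: *(2,4)) (simp add: algebra_simps)
    moreover have "?E (Q * Q') \<noteq> 0" using * by (simp add: E.mult)
    ultimately show "a + b \<in> S" "a * b \<in> S" unfolding S_def by blast+
  next
    fix a
    assume "a \<in> S"
    then obtain P Q where *: "?E Q \<noteq> 0" "a * ?E Q = ?E P" unfolding S_def by blast
    show "inverse a \<in> S"
    proof (cases "a = 0")
      case True
      then show ?thesis using \<open>a \<in> S\<close> by simp
    next
      case False
      then have "?E P \<noteq> 0" "inverse a * ?E P = ?E Q"
        using * by (auto simp flip: *(2))
      then show ?thesis unfolding S_def by blast
    qed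
  next
    fix x :: "'a fls fls"
    assume "x \<in> range fls2_const"
    then obtain k where "x = fls2_const k" by blast
    then have "x * ?E 1 = ?E [:[:k:]:]" "?E 1 \<noteq> 0"
      by (simp_all add: E.one cU.poly_hom_pCons cU.poly_hom_0 c2.poly_hom_pCons c2.poly_hom_0)
    then show "x \<in> S" unfolding S_def by blast
  qed
  moreover have "W * ?E 1 = ?E [:0, 1:]" "U * ?E 1 = ?E [:[:0, 1:]:]" "?E 1 \<noteq> 0"
    by (simp_all add: E.one cU.one cU.zero cU.poly_hom_pCons cU.poly_hom_0 c2.poly_hom_pCons c2.poly_hom_0)
  then have "W \<in> S" "U \<in> S" unfolding S_def by blast+
  ultimately have "fls_const f \<in> S" by (rule gen)
  then obtain P Q where *: "?E Q \<noteq> 0" "fls_const f * ?E Q = ?E P"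
    unfolding S_def by blast
  have "Q \<noteq> 0" using * E.zero by auto
  then obtain i q where q: "q \<noteq> 0" "fls_subdegree (?E Q) = int i * fls_subdegree W"
    "fls_lead (?E Q) = fls_lead W ^ i * ?e q"
    using lead by blast
  have "P \<noteq> 0" using * E.zero f by auto
  then obtain k p where p: "fls_subdegree (?E P) = int k * fls_subdegree W"
    "fls_lead (?E P) = fls_lead W ^ k * ?e p"
    using lead by blast
  \<comment> \<open>\<open>fls_const f\<close> has order 0 in y, so both sides carry the same power
    of \<open>W\<close>, and its leading coefficient cancels.\<close>
  have "fls_subdegree (?E P) = fls_subdegree (?E Q)"
    using *(1) f by (simp flip: *(2))
  then have "k = i" using W p q by simp
  have "fls_lead (?E P) = f * fls_lead (?E Q)"
    by (simp add: fls_lead_mult flip: *(2)) (simp add: fls_lead_def)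
  then have "?e p = f * ?e q"
    using W0 unfolding p(2) q(3) \<open>k = i\<close> by (simp add: mult.left_commute)
  with q(1) that show thesis by blast
qed

text \<open>The constant term in y of the identity reads \<kappa> V^(j-1) dV = x^(-m-1) dx, where V
  is the residue of \<open>U\<close>. Integrating gives V^j = \<alpha> x^(-m) + \<beta>, and x lies
  in k(V), so \<open>power_parametrization\<close> applies.\<close>

lemma terminal_chart_pos:
  fixes W U g :: "'a :: field_char_0 fls fls"
  assumes m: "m \<ge> 1" and j: "j \<ge> 1" and W: "fls_subdegree W > 0" and U: "U \<noteq> 0" "fls_subdegree U = 0"
    and g: "fls_subdegree g = 0" "g $$ 0 = fls_const \<gamma>" "\<gamma> \<noteq> 0"
    and eq: "g * U ^ j * logJ W U = fls_const (fls_X_inv ^ (m + 1))"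
    and gen: "\<And>S. subfield_over fls2_const S \<Longrightarrow> W \<in> S \<Longrightarrow> U \<in> S \<Longrightarrow> fls_const fls_X \<in> S"
  shows "m = 1 \<or> m = j"
proof -
  define h where "h = fls_subdegree W"
  define V where "V = U $$ 0"
  have V: "V \<noteq> 0" "fls_lead U = V" using U nth_fls_subdegree_nonzero[of U] by (simp_all add: V_def fls_lead_def)
  have W0: "W \<noteq> 0" using W by auto
  have lJ: "fls_subdegree (logJ W U) \<ge> 0" "logJ W U $$ 0 = - of_int h * (fls_deriv V / V)"
    using logJ_lead[OF W0 U(1)] U V by (simp_all add: h_def)
  have Uj: "fls_subdegree (U ^ j) = 0" "(U ^ j) $$ 0 = V ^ j"
    using fls_lead_power[of U j] U V by (simp_all add: fls_subdegree_pow fls_lead_def)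
  have "fls_const \<gamma> * V ^ j * (- of_int h * (fls_deriv V / V)) = fls_X_inv ^ (m + 1)"
    using arg_cong[OF eq, of "\<lambda>f. f $$ 0"] lJ Uj g fls_mult_subdegree_ge_0[of g "U ^ j"]
    by (simp add: fls_times_nth_0)
  then have *: "of_int (- h) * fls_const \<gamma> * (V ^ j * (fls_deriv V / V)) = fls_X_inv ^ (m + 1)"
    by (simp add: algebra_simps)
  have V': "fls_deriv V \<noteq> 0"
  proof
    assume "fls_deriv V = 0"
    with * have "fls_X_inv ^ (m + 1) = (0 :: 'a fls)" by simp
    then show False by simp
  qed
  define \<kappa> where "\<kappa> = - (of_int h * \<gamma>)"
  have \<kappa>: "\<kappa> \<noteq> 0" using g W by (simp add: \<kappa>_def h_def)
  have der: "alg_derivation (fls_const :: 'a \<Rightarrow> _) fls_deriv"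
    unfolding alg_derivation_def by (simp add: algebra_simps)
  define \<alpha> where "\<alpha> = - of_nat j / (\<kappa> * of_nat m)"
  have \<alpha>: "\<alpha> \<noteq> 0" using j m \<kappa> by (simp add: \<alpha>_def)
  have 1: "fls_const \<kappa> * (V ^ j * (fls_deriv V / V)) = fls_X_inv ^ (m + 1)"
    using * by (simp add: \<kappa>_def fls_of_int flip: fls_const_mult_const)
  have "fls_deriv (V ^ j) = of_nat j * (V ^ j * (fls_deriv V / V))"
    using derivation_power[OF der, of V j] V(1) by (simp add: field_simps)
  also have "V ^ j * (fls_deriv V / V) = fls_const (inverse \<kappa>) * fls_X_inv ^ (m + 1)"
    unfolding 1[symmetric] using \<kappa> by (simp flip: mult.assoc)
  also have "of_nat j * (fls_const (inverse \<kappa>) * fls_X_inv ^ (m + 1)) = fls_deriv (fls_const \<alpha> * fls_X_inv ^ m)"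
  proof -
    have "fls_deriv (fls_X_inv ^ m) = - of_nat m * (fls_X_inv ^ (m + 1) :: 'a fls)"
      using fls_deriv_X_inv_power[of m] by simp
    moreover have "of_nat j * fls_const (inverse \<kappa>) = fls_const \<alpha> * (- of_nat m)"
      using m \<kappa> by (simp add: \<alpha>_def fls_of_nat field_simps)
    ultimately show ?thesis by (simp add: mult.assoc[symmetric])
  qed
  finally obtain \<beta> where "V ^ j = fls_const \<beta> + fls_const \<alpha> * fls_X_inv ^ m"
    unfolding fls_deriv_eq_iff_ex by blast
  then have Vj: "V ^ j = fls_const \<alpha> * fls_X_inv ^ m + fls_const \<beta>" by (simp add: add.commute)
  have "(fls_X :: 'a fls) \<noteq> 0" by simp
  with residue_in_generated_field[OF W U(2) V'[unfolded V_def] gen] obtain P Q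
    where "Q \<noteq> 0" "poly_hom fls_const V P = fls_X * poly_hom fls_const V Q"
    unfolding V_def by blast
  with power_parametrization[OF m j \<alpha> Vj] show ?thesis by blast
qed

lemma terminal_chart:
  fixes W U g :: "'a :: field_char_0 fls fls"
  assumes m: "m \<ge> 1" and W: "fls_subdegree W > 0" and U: "U \<noteq> 0" "fls_subdegree U = 0"
    and g: "fls_subdegree g = 0" "g $$ 0 = fls_const \<gamma>" "\<gamma> \<noteq> 0"
    and eq: "g * U powi j * logJ W U = fls_const (fls_X_inv ^ (m + 1))"
    and gen: "\<And>S. subfield_over fls2_const S \<Longrightarrow> W \<in> S \<Longrightarrow> U \<in> S \<Longrightarrow> fls_const fls_X \<in> S"
  shows "m = 1 \<or> int m = \<bar>j\<bar>"
proof -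
  have W0: "W \<noteq> 0" using W by auto
  consider "j > 0" | "j = 0" | "j < 0" by linarith
  then show ?thesis
  proof cases
    case 1
    then obtain k where k: "j = int k" "k \<ge> 1" by (metis nonneg_int_cases of_nat_0_less_iff less_imp_le Suc_le_eq One_nat_def)
    with eq have "g * U ^ k * logJ W U = fls_const (fls_X_inv ^ (m + 1))" by simp
    from terminal_chart_pos[OF m k(2) W U g this gen] k show ?thesis by simp
  next
    \<comment> \<open>Contradictory case: dlog V has at most a simple pole in x, while x^(-m-1) dx
      has a pole of order m + 1.\<close>
    case 2
    define V where "V = fls_lead U"
    have V: "V \<noteq> 0" using U by (simp add: V_def)
    have lJ: "fls_subdegree (logJ W U) \<ge> 0"
      "logJ W U $$ 0 = - of_int (fls_subdegree W) * (fls_deriv V / V)"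
      using logJ_lead[OF W0 U(1)] U by (simp_all add: V_def)
    have "fls_const \<gamma> * (- of_int (fls_subdegree W) * (fls_deriv V / V)) = fls_X_inv ^ (m + 1)"
      using arg_cong[OF eq, of "\<lambda>f. f $$ 0"] lJ g 2 by (simp add: fls_times_nth_0)
    then have "fls_X * (fls_const \<gamma> * (- of_int (fls_subdegree W) * (fls_deriv V / V))) = fls_X_inv ^ m"
      using fls_X_nonzero by (simp flip: mult.assoc fls_inverse_X)
    then have "fls_const (- \<gamma> * of_int (fls_subdegree W)) * (fls_X * fls_deriv V / V) = fls_X_inv ^ m"
      by (simp add: fls_of_int algebra_simps flip: fls_const_mult_const)
    moreover have "fls_subdegree (fls_X * fls_deriv V / V) \<ge> 0"
      using V by (intro fls_divide_ge) (auto simp: fls_X_times_conv_shift)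
    ultimately have "(fls_X_inv ^ m :: 'a fls) $$ (- int m) = 0"
      using m by (metis fls_eq0_below_subdegree fls_mult_const_nth(1) mult_zero_right
          neg_less_0_iff_less of_nat_0_less_iff order_less_le_trans less_le_trans zero_less_one)
    then show ?thesis by (simp add: fls_X_inv_power_conv_shift_1)
  next
    \<comment> \<open>Passing to 1/U makes the exponent positive and changes the sign of
      \<open>logJ\<close>, which \<open>g\<close> absorbs.\<close>
    case 3
    then obtain k where k: "j = - int k" "k \<ge> 1"
      by (metis neg_int_cases Suc_le_eq One_nat_def)
    have "logJ (W powi 1 * U powi 0) (W powi 0 * U powi (-1)) = - logJ W U"
      using logJ_monomials[OF W0 U(1), of 1 0 0 "-1"] by simp
    then have J: "logJ W (inverse U) = - logJ W U" by (simp add: power_int_minus)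
    have "- g * inverse U ^ k * logJ W (inverse U) = fls_const (fls_X_inv ^ (m + 1))"
      unfolding J using eq by (simp add: k power_int_minus power_inverse)
    moreover have "fls_const fls_X \<in> S" if "subfield_over fls2_const S" "W \<in> S" "inverse U \<in> S" for S
      using gen[of S] that subfield_overD(4)[OF that(1,3)] by simp
    ultimately have "m = 1 \<or> m = k"
      using terminal_chart_pos[OF m k(2) W, of "inverse U" "- g" "- \<gamma>"] U g by simp
    with k show ?thesis by simp
  qed
qed

section \<open>Descent on the order of the form\<close>

lemma monomial_powi_mult:
  fixes w u :: "'a :: field"
  assumes "w \<noteq> 0" "u \<noteq> 0"
  shows "(w powi r * u powi s) powi a * (w powi t * u powi v) powi b =
    w powi (r * a + t * b) * u powi (s * a + v * b)"
  using assms by (simp add: power_int_mult_distrib power_int_add mult_ac flip: power_int_mult)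

text \<open>Let A = i ord w + j ord u; it is at most 0 because \<open>logJ w u\<close> has order -A.
  If A = 0, a monomial change reaches \<open>terminal_chart\<close>. Otherwise a monomial change and
  a translation raise A.\<close>

lemma descent:
  fixes w u g :: "'a :: field_char_0 fls fls" and i j :: int
  assumes m: "m \<ge> 1" and w: "w \<noteq> 0" and u: "u \<noteq> 0"
    and g: "fls_subdegree g = 0" "g $$ 0 = fls_const \<gamma>" "\<gamma> \<noteq> 0"
    and eq: "g * (w powi i * u powi j) * logJ w u = fls_const (fls_X_inv ^ (m + 1))"
    and gen: "\<And>S. subfield_over fls2_const S \<Longrightarrow> w \<in> S \<Longrightarrow> u \<in> S \<Longrightarrow> fls_const fls_X \<in> S"
  shows "m = 1 \<or> int m = gcd i j"
  using w u g eq gen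
proof (induction "nat (- (i * fls_subdegree w + j * fls_subdegree u))"
    arbitrary: w u g \<gamma> i j rule: less_induct)
  case less
  note w = less.prems(1) and u = less.prems(2) and g = less.prems(3-5) and eq = less.prems(6)
    and gen = less.prems(7)
  define d where "d = fls_subdegree w"
  define e where "e = fls_subdegree u"
  define A where "A = i * d + j * e"
  have rhs: "fls_const (fls_X_inv ^ (m + 1)) \<noteq> (0 :: 'a fls fls)" by simp
  have g0: "g \<noteq> 0" using g by auto
  have J0: "logJ w u \<noteq> 0" using eq rhs by (metis mult_zero_right)
  have "fls_subdegree (g * (w powi i * u powi j) * logJ w u) = A + fls_subdegree (logJ w u)"
    using g0 w u J0 g by (simp add: A_def d_def e_def)
  then have vJ: "fls_subdegree (logJ w u) = - A" unfolding eq by simp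
  then have A: "A \<le> 0" using logJ_lead(1)[OF w u] by simp
  \<comment> \<open>If both orders were 0, the constant term of \<open>logJ w u\<close> would vanish
    although its order is -A = 0.\<close>
  have de: "d \<noteq> 0 \<or> e \<noteq> 0"
  proof (rule ccontr)
    assume "\<not> (d \<noteq> 0 \<or> e \<noteq> 0)"
    then have "A = 0" "logJ w u $$ 0 = 0"
      using logJ_lead(2)[OF w u] by (simp_all add: A_def d_def e_def)
    with vJ J0 nth_fls_subdegree_nonzero[of "logJ w u"] show False by simp
  qed
  define h where "h = gcd d e"
  have h: "h > 0" using de by (simp add: h_def)
  obtain p q where dp: "d = p * h" and eq': "e = q * h"
    unfolding h_def by (metis dvd_div_mult_self gcd_dvd1 gcd_dvd2)
  obtain r s where "r * d + s * e = h" using bezout_int[of d e] unfolding h_def by blast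
  then have "(r * p + s * q) * h = 1 * h" by (simp add: dp eq' algebra_simps)
  then have det: "r * p + s * q = 1" using h by simp
  \<comment> \<open>Unimodular change of coordinates from the Bezout coefficients: \<open>W\<close>
    gets order h and \<open>U\<close> order 0.\<close>
  define W where "W = w powi r * u powi s"
  define U where "U = w powi (- q) * u powi p"
  have W0: "W \<noteq> 0" and U0: "U \<noteq> 0" using w u by (simp_all add: W_def U_def)
  have vW: "fls_subdegree W = h" and vU: "fls_subdegree U = 0"
    using w u \<open>r * d + s * e = h\<close> by (simp_all add: W_def U_def dp eq' flip: d_def e_def)
  have J: "logJ W U = logJ w u"
    unfolding W_def U_def logJ_monomials[OF w u] using det by (simp add: algebra_simps)
  define i' where "i' = i * p + j * q"
  define j' where "j' = - i * s + j * r"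
  have ij: "i = r * i' - q * j'" "j = s * i' + p * j'"
  proof -
    have "r * i' - q * j' = i * (r * p + s * q)" "s * i' + p * j' = j * (r * p + s * q)"
      by (simp_all add: i'_def j'_def algebra_simps)
    then show "i = r * i' - q * j'" "j = s * i' + p * j'" by (simp_all add: det)
  qed
  have A': "A = i' * h" by (simp add: A_def i'_def dp eq' algebra_simps)
  have mon: "w powi i * u powi j = W powi i' * U powi j'"
    unfolding W_def U_def monomial_powi_mult[OF w u] by (simp add: ij)
  have inv: "w = W powi p * U powi (- s)" "u = W powi q * U powi r"
    unfolding W_def U_def monomial_powi_mult[OF w u] using det by (simp_all add: algebra_simps)
  have genWU: "fls_const fls_X \<in> S" if S: "subfield_over fls2_const S" "W \<in> S" "U \<in> S" for S
  proof -
    note powi = subfield_over_power_int[OF comm_ring_hom_fls2_const S(1)]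
    have "w \<in> S"
      unfolding inv(1) by (rule subfield_overD(3)[OF S(1) powi[OF S(2)] powi[OF S(3)]])
    moreover have "u \<in> S"
      unfolding inv(2) by (rule subfield_overD(3)[OF S(1) powi[OF S(2)] powi[OF S(3)]])
    ultimately show ?thesis using gen[OF S(1)] by blast
  qed
  show ?case
  proof (cases "A = 0")
    case True
    then have i': "i' = 0" using A' h by simp
    then have "g * U powi j' * logJ W U = fls_const (fls_X_inv ^ (m + 1))"
      using eq by (simp add: mon J)
    moreover have "fls_subdegree W > 0" using vW h by simp
    ultimately have "m = 1 \<or> int m = \<bar>j'\<bar>"
      using terminal_chart[OF m _ U0 vU g _ genWU] by blast
    \<comment> \<open>Here i = -q j' and j = p j' with p and q coprime.\<close>
    moreover have "gcd i j = \<bar>j'\<bar>"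
    proof -
      have "gcd q p dvd r * p + s * q" by simp
      then have "gcd q p = 1" unfolding det by simp
      then show ?thesis
        using gcd_mult_distrib_int[of j' q p] unfolding ij i' by (simp add: mult.commute)
    qed
    ultimately show ?thesis by simp
  next
    case False
    then have neg: "A < 0" using A by simp
    \<comment> \<open>Since \<open>logJ\<close> has positive order, its constant term, -h times dlog
      of the leading coefficient of \<open>U\<close>, vanishes; so that coefficient is a constant
      \<open>c\<close>.\<close>
    have "logJ W U $$ 0 = 0" using vJ neg by (simp add: J)
    then have "fls_deriv (fls_lead U) = 0"
      using logJ_lead(2)[OF W0 U0] U0 vU vW h by simp
    then obtain c where c: "fls_lead U = fls_const c" by (metis fls_deriv_eq_0_iff)
    have c0: "c \<noteq> 0" using c U0 by (metis fls_const_0 fls_lead_eq_0_iff)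
    define u' where "u' = U - fls2_const c"
    have "U \<noteq> fls2_const c"
    proof
      assume "U = fls2_const c"
      then have "logJ W U = 0"
        by (simp add: logJ_def logDX_def logDY_def alg_derivationD(3)[OF alg_derivation_fls(1)])
      with J J0 show False by simp
    qed
    then have u'0: "u' \<noteq> 0" by (simp add: u'_def)
    have "fls_subdegree u' > 0"
    proof (rule fls_subdegree_greaterI[OF u'0])
      fix k :: int
      assume "k \<le> 0"
      then show "u' $$ k = 0" using c vU by (cases "k = 0") (simp_all add: u'_def fls_lead_def)
    qed
    \<comment> \<open>Since U dlog U = u' dlog u', the translated coordinate enters with exponent 1.
      The remaining power of \<open>U\<close> is a unit with constant residue, so it joins
      \<open>g\<close>.\<close>
    define g' where "g' = g * U powi (j' - 1)"
    have g': "fls_subdegree g' = 0" "g' $$ 0 = fls_const (\<gamma> * c powi (j' - 1))"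
    proof -
      show "fls_subdegree g' = 0" using g0 U0 g vU by (simp add: g'_def)
      then have "g' $$ 0 = fls_lead g'" by (simp add: fls_lead_def)
      also have "\<dots> = fls_const (\<gamma> * c powi (j' - 1))"
        using g by (simp add: g'_def fls_lead_mult fls_lead_power_int c fls_const_power_int)
          (simp add: fls_lead_def fls_const_power_int flip: fls_const_mult_const)
      finally show "g' $$ 0 = fls_const (\<gamma> * c powi (j' - 1))" .
    qed
    have "g' * (W powi i' * u' powi 1) * logJ W u' = g' * W powi i' * (logJ W u' * u')"
      by simp
    also have "logJ W u' * u' = logJ W U * U"
      unfolding u'_def by (rule logJ_diff_const) (use U0 u'0 u'_def in auto)
    also have "g' * W powi i' * (logJ W U * U) = g * (W powi i' * U powi j') * logJ W U"
      using U0 by (simp add: g'_def power_int_diff)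
    also have "\<dots> = fls_const (fls_X_inv ^ (m + 1))"
      using eq by (simp add: mon J)
    finally have "g' * (W powi i' * u' powi 1) * logJ W u' = fls_const (fls_X_inv ^ (m + 1))" .
    \<comment> \<open>The new order is A + ord u', and ord u' is positive.\<close>
    moreover have "nat (- (i' * fls_subdegree W + 1 * fls_subdegree u')) <
        nat (- (i * fls_subdegree w + j * fls_subdegree u))"
      using neg \<open>fls_subdegree u' > 0\<close> A' unfolding vW by (simp add: A_def d_def e_def)
    moreover have "fls_const fls_X \<in> S" if S: "subfield_over fls2_const S" "W \<in> S" "u' \<in> S" for S
    proof -
      have "U = u' + fls2_const c" by (simp add: u'_def)
      then have "U \<in> S" using subfield_overD(1,2)[OF S(1)] S(3) by metis
      then show ?thesis using genWU S by blast
    qed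
    moreover have "\<gamma> * c powi (j' - 1) \<noteq> 0" using g c0 by simp
    \<comment> \<open>With second exponent 1 the gcd is 1, so both alternatives give m = 1.\<close>
    ultimately have "m = 1 \<or> int m = gcd i' 1"
      using less.hyps[OF _ W0 u'0 g'] by blast
    then show ?thesis by simp
  qed
qed

text \<open>The images g and h of x and y satisfy g^(-n) dlog g \<and> dlog h = x^(-m-1) dx \<and>
  dlog y, so the descent starts from exponents -n and 0, with gcd n. Allowing n = 1 covers the Weyl
  field.\<close>

lemma K_1_0_iso_eq:
  assumes m: "m \<ge> 2" and n: "n \<ge> 1"
    and iso: "(K_1_0 n :: 'a :: field_char_0 ratfun2 \<Rightarrow> 'a ratfun2 \<Rightarrow> 'a ratfun2) \<cong>\<^sub>P K_1_0 m"
  shows "m = n"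
proof -
  obtain \<phi> :: "'a ratfun2 \<Rightarrow> 'a ratfun2" where "poisson_isomorphism (K_1_0 n) (K_1_0 m) \<phi>"
    using iso unfolding poisson_isomorphic_def by blast
  note \<phi> = poisson_isomorphismD[OF this[unfolded K_1_0_def]]
  interpret \<phi>: field_hom \<phi> by (fact \<phi>)
  obtain \<iota> :: "'a ratfun2 \<Rightarrow> 'a fls fls" where \<iota>: "field_hom \<iota>" "\<And>k. \<iota> (ratconst k) = fls2_const k"
    "\<iota> ratX = fls_const fls_X" "\<iota> ratY = fls_X"
    "\<And>g. fls_coeff_deriv (\<iota> g) = \<iota> (ratDX g)" "\<And>g. fls_deriv (\<iota> g) = \<iota> (ratDY g)"
    by (rule ratfun_fls_hom) blast
  interpret \<iota>: field_hom \<iota> by (fact \<iota>)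
  define g where "g = \<phi> ratX"
  define h where "h = \<phi> ratY"
  have nz: "g \<noteq> 0" "h \<noteq> 0" using \<phi>(4,5) by (simp_all add: g_def h_def)
  have XY: "ratX \<noteq> (0 :: 'a ratfun2)" "ratY \<noteq> (0 :: 'a ratfun2)"
    by (simp_all add: ratX_def ratY_def)
  have "ratJ g h * (ratX ^ (m + 1) * ratY) = g ^ (n + 1) * h"
    using \<phi>(3) by (simp add: g_def h_def \<phi>.mult \<phi>.power)
  then have "inverse g ^ n * (ratY * ratJ g h / (g * h)) = inverse ratX ^ (m + 1)"
    using nz XY by (simp add: field_simps)
  then have "\<iota> (inverse g ^ n) * \<iota> (ratY * ratJ g h / (g * h)) = \<iota> (inverse ratX ^ (m + 1))"
    by (simp only: flip: \<iota>.mult)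
  also have "\<iota> (inverse ratX ^ (m + 1)) = fls_const (fls_X_inv ^ (m + 1))"
    by (simp only: \<iota>.power \<iota>.inverse \<iota>(3) fls_inverse_const fls_inverse_X fls_const_power)
  finally have "1 * (\<iota> g powi (- int n) * \<iota> h powi 0) * logJ (\<iota> g) (\<iota> h) = fls_const (fls_X_inv ^ (m + 1))"
    unfolding ratfun_hom_logJ[OF \<iota>(1,5,6,4) nz]
    by (simp add: \<iota>.power \<iota>.inverse power_int_minus power_inverse)
  \<comment> \<open>By surjectivity of \<phi>, x is a rational function of g and h.\<close>
  moreover have "fls_const fls_X \<in> S"
    if S: "subfield_over fls2_const S" "\<iota> g \<in> S" "\<iota> h \<in> S" for S
  proof -
    have "subfield_over ratconst {f. \<iota> (\<phi> f) \<in> S}"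
      using subfield_overD[OF S(1)] unfolding subfield_over_def
      by (auto simp: \<phi>.add \<phi>.mult \<phi>.inverse \<phi>(2) \<iota>.add \<iota>.mult \<iota>.inverse \<iota>(2))
    then have "f \<in> {f. \<iota> (\<phi> f) \<in> S}" for f
      by (rule ratfun_mem_subfield) (use S in \<open>simp_all add: g_def h_def\<close>)
    moreover obtain f where "ratX = \<phi> f" using \<phi>(6) by (auto simp: bij_def elim: surjE)
    ultimately show ?thesis using \<iota>(3) by (metis mem_Collect_eq)
  qed
  moreover have "\<iota> g \<noteq> 0" "\<iota> h \<noteq> 0" using nz by (simp_all add: \<iota>.eq_0_iff)
  moreover have "m \<ge> 1" "fls_subdegree (1 :: 'a fls fls) = 0" "(1 :: 'a fls fls) $$ 0 = fls_const 1"
    using m by simp_all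
  ultimately have "m = 1 \<or> int m = gcd (- int n) 0"
    using descent[of m "\<iota> g" "\<iota> h" 1 1 "- int n" 0] one_neq_zero by blast
  with m show ?thesis by simp
qed

section \<open>Pairwise comparison of the three classes\<close>

lemma poisson_isomorphic_trans:
  assumes "B \<cong>\<^sub>P B'" "B' \<cong>\<^sub>P B''"
  shows "B \<cong>\<^sub>P B''"
proof -
  obtain \<phi> \<psi> where *: "poisson_isomorphism B B' \<phi>" "poisson_isomorphism B' B'' \<psi>"
    using assms unfolding poisson_isomorphic_def by blast
  then have "poisson_isomorphism B B'' (\<psi> \<circ> \<phi>)"
    unfolding poisson_isomorphism_def by (auto intro: bij_comp)
  then show ?thesis unfolding poisson_isomorphic_def by blast
qed

text \<open>Each parameter is an integer multiple of the other, and the two integers have product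
  1.\<close>

lemma K_q_iso_iff:
  fixes q q' :: "'a :: field_char_0"
  assumes q: "q \<noteq> 0" "q' \<noteq> 0"
  shows "K_q q \<cong>\<^sub>P K_q q' \<longleftrightarrow> q' = q \<or> q' = - q"
proof
  assume iso: "K_q q \<cong>\<^sub>P K_q q'"
  obtain N where N: "q = of_int N * q'"
    using K_q_iso_integer_multiple[OF iso q(2)] by blast
  obtain M where M: "q' = of_int M * q"
    using K_q_iso_integer_multiple[OF poisson_isomorphic_sym[OF iso] q(1)] by blast
  have "of_int (N * M) * q = 1 * q" using N M by (metis mult.assoc mult_1 of_int_mult)
  then have "N * M = 1" using q by (metis mult_right_cancel of_int_eq_1_iff)
  then have "M = 1 \<or> M = - 1" by (metis mult.commute zmult_eq_1_iff)
  then show "q' = q \<or> q' = - q" using M by auto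
next
  assume "q' = q \<or> q' = - q"
  then show "K_q q \<cong>\<^sub>P K_q q'" using poisson_isomorphic_refl K_q_iso_neg by blast
qed

theorem proposition4p6:
  shows "((K_Weyl :: 'a :: field_char_0 ratfun2 \<Rightarrow> 'a ratfun2 \<Rightarrow> 'a ratfun2) \<cong>\<^sub>P K_1_0 1) \<and>
    (\<forall>q q' :: 'a. q \<noteq> 0 \<longrightarrow> q' \<noteq> 0 \<longrightarrow>
       (K_q q \<cong>\<^sub>P K_q q' \<longleftrightarrow> q' = q \<or> q' = - q)) \<and>
    (\<forall>m n :: nat. m \<ge> 2 \<longrightarrow> n \<ge> 2 \<longrightarrow>
       (K_1_0 n :: 'a ratfun2 \<Rightarrow> 'a ratfun2 \<Rightarrow> 'a ratfun2) \<cong>\<^sub>P K_1_0 m \<longrightarrow> m = n) \<and>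
    (\<forall>q :: 'a. q \<noteq> 0 \<longrightarrow> \<not> K_q q \<cong>\<^sub>P K_Weyl) \<and>
    (\<forall>(q :: 'a) (n :: nat). q \<noteq> 0 \<longrightarrow> n \<ge> 2 \<longrightarrow> \<not> K_q q \<cong>\<^sub>P K_1_0 n) \<and>
    (\<forall>n :: nat. n \<ge> 2 \<longrightarrow>
       \<not> (K_Weyl :: 'a ratfun2 \<Rightarrow> 'a ratfun2 \<Rightarrow> 'a ratfun2) \<cong>\<^sub>P K_1_0 n)"
proof (intro conjI allI impI)
  show Weyl: "(K_Weyl :: 'a ratfun2 \<Rightarrow> 'a ratfun2 \<Rightarrow> 'a ratfun2) \<cong>\<^sub>P K_1_0 1"
    by (rule K_Weyl_iso_K_1_0)
  fix q q' :: 'a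
  assume q: "q \<noteq> 0"
  show "K_q q \<cong>\<^sub>P K_q q' \<longleftrightarrow> q' = q \<or> q' = - q" if "q' \<noteq> 0"
    using q that by (rule K_q_iso_iff)
  show "\<not> K_q q \<cong>\<^sub>P K_Weyl"
    using K_q_not_iso_K_1_0[OF q, of 1] poisson_isomorphic_sym[OF poisson_isomorphic_trans[OF _ Weyl]]
    by auto
  show "\<not> K_q q \<cong>\<^sub>P K_1_0 n" if "n \<ge> 2" for n
    using K_q_not_iso_K_1_0[OF q, of n] poisson_isomorphic_sym that by auto
next
  fix m n :: nat
  assume "m \<ge> 2" "n \<ge> 2" and iso: "(K_1_0 n :: 'a ratfun2 \<Rightarrow> 'a ratfun2 \<Rightarrow> 'a ratfun2) \<cong>\<^sub>P K_1_0 m"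
  then show "m = n" by (intro K_1_0_iso_eq[OF _ _ iso]) auto
next
  fix n :: nat
  assume n: "n \<ge> 2"
  show "\<not> (K_Weyl :: 'a ratfun2 \<Rightarrow> 'a ratfun2 \<Rightarrow> 'a ratfun2) \<cong>\<^sub>P K_1_0 n"
  proof
    assume "(K_Weyl :: 'a ratfun2 \<Rightarrow> 'a ratfun2 \<Rightarrow> 'a ratfun2) \<cong>\<^sub>P K_1_0 n"
    then have "(K_1_0 1 :: 'a ratfun2 \<Rightarrow> 'a ratfun2 \<Rightarrow> 'a ratfun2) \<cong>\<^sub>P K_1_0 n"
      by (rule poisson_isomorphic_trans[OF poisson_isomorphic_sym[OF K_Weyl_iso_K_1_0]])
    from K_1_0_iso_eq[OF n _ this] n show False by simp
  qed
qed

end
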